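(* Let $n$ be a positive integer. For every positive integer $p$, the rectangular Capelli-Deruyts bitableau $\mathbf{K}_n^p$ (with $p$ rows of length $n$) is a central element of $\mathbf{U}(gl(n))$.
   Context: Capelli bitableaux. Let $\mathcal{A}_0=\{\alpha_1,\dots,\alpha_{m}\}$ ($m$ sufficiently large) be a set of virtual symbols, with $|\alpha_s|=0\in\mathbb{Z}_2$, and $\mathcal{L}=\{1,\dots,n\}$ the proper symbols, with $|i|=1\in\mathbb{Z}_2$. Let $gl(m|n)$ be the complex Lie superalgebra with basis $e_{a,b}$, $a,b\in\mathcal{A}_0\cup\mathcal{L}$, of parity $|a|+|b|$, and superbracket $[e_{a,b},e_{c,d}]=\delta_{bc}e_{a,d}-(-1)^{(|a|+|b|)(|c|+|d|)}\delta_{ad}e_{c,b}$. The enveloping algebra $\mathbf{U}(gl(n))$ is the subalgebra of $\mathbf{U}(gl(m|n))$ generated by the $e_{i,j}$, $i,j\in\mathcal{L}$. A product $e_{a_r,b_r}\cdots e_{a_1,b_1}$ is irregular if there are $i\le r$ and $\gamma\in\mathcal{A}_0$ with $\#\{j\le i: b_j=\gamma\}>\#\{j<i: a_j=\gamma\}$. Let $\mathbf{Irr}$ be the left ideal of $\mathbf{U}(gl(m|n))$ generated by the irregular products. It is known that $\mathbf{U}(gl(n))\cap\mathbf{Irr}=0$, that $Virt(m,n)=\mathbf{U}(gl(n))\oplus\mathbf{Irr}$ is a subalgebra, and that $\mathbf{Irr}$ is a two-sided ideal of it; the Capelli devirtualization epimorphism $\mathfrak{p}:Virt(m,n)\to\mathbf{U}(gl(n))$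 is the projection with kernel $\mathbf{Irr}$. For Young tableaux $S=(s_{ij})$, $T=(t_{ij})$ of the same shape $\lambda=(\lambda_1\ge\dots\ge\lambda_p)$ with entries in $\mathcal{L}$, the Capelli bitableau is $$[S|T]=\mathfrak{p}\Big(\prod_{i=1}^{p}\big(e_{s_{i1},\alpha_i}e_{s_{i2},\alpha_i}\cdots e_{s_{i\lambda_i},\alpha_i}\big)\cdot\prod_{i=1}^{p}\big(e_{\alpha_i,t_{i1}}e_{\alpha_i,t_{i2}}\cdots e_{\alpha_i,t_{i\lambda_i}}\big)\Big),$$ with products ordered from left to right by increasing $i$ and $\alpha_1,\dots,\alpha_p$ distinct virtual symbols (the argument lies in $Virt(m,n)$ and the result does not depend on the choice of the $\alpha_i$). $\mathbf{K}_n^p=[S|T]$ where $S$ and $T$ have $p$ rows, every row of $S$ is $n\ (n-1)\ \cdots\ 2\ 1$ and every row of $T$ is $1\ 2\ \cdots\ n$. *)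

theory Defs
  imports "HOL-Algebra.QuotRing" "HOL-Algebra.Generated_Rings" "HOL-Library.Poly_Mapping" Complex_Main
begin

section \<open>Free associative algebras\<close>

text \<open>Words form a monoid under concatenation, written additively because the convolution
  product of \<^typ>\<open>'a \<Rightarrow>\<^sub>0 'b\<close> is indexed by an additive monoid. Hence
  \<open>'a word \<Rightarrow>\<^sub>0 complex\<close> is the free associative unital complex algebra on \<open>'a\<close>.\<close>

datatype 'a word = Word (letters: "'a list")

instantiation word :: (type) monoid_add
begin

definition zero_word :: "'a word" where "0 = Word []"

definition plus_word :: "'a word \<Rightarrow> 'a word \<Rightarrow> 'a word"
  where "v + w = Word (letters v @ letters w)"

instance
  by standard (simp_all add: zero_word_def plus_word_def)

end

definition free_algebra :: "'a set \<Rightarrow> ('a word \<Rightarrow>\<^sub>0 complex) ring" where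
  "free_algebra B =
     \<lparr>carrier = {f. \<forall>w \<in> Poly_Mapping.keys f. set (letters w) \<subseteq> B},
      monoid.mult = (*), one = 1, ring.zero = 0, add = (+)\<rparr>"

lemma free_algebra_simps:
  "f \<in> carrier (free_algebra B) \<longleftrightarrow> (\<forall>w \<in> Poly_Mapping.keys f. set (letters w) \<subseteq> B)"
  "f \<otimes>\<^bsub>free_algebra B\<^esub> g = f * g"
  "f \<oplus>\<^bsub>free_algebra B\<^esub> g = f + g"
  "\<one>\<^bsub>free_algebra B\<^esub> = 1"
  "\<zero>\<^bsub>free_algebra B\<^esub> = 0"
  by (simp_all add: free_algebra_def)

lemma free_algebra_closed:
  shows free_algebra_zero: "0 \<in> carrier (free_algebra B)"
    and free_algebra_one: "1 \<in> carrier (free_algebra B)"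
    and free_algebra_uminus: "f \<in> carrier (free_algebra B) \<Longrightarrow> - f \<in> carrier (free_algebra B)"
    and free_algebra_add: "\<lbrakk>f \<in> carrier (free_algebra B); g \<in> carrier (free_algebra B)\<rbrakk>
          \<Longrightarrow> f + g \<in> carrier (free_algebra B)"
    and free_algebra_diff: "\<lbrakk>f \<in> carrier (free_algebra B); g \<in> carrier (free_algebra B)\<rbrakk>
          \<Longrightarrow> f - g \<in> carrier (free_algebra B)"
    and free_algebra_mult: "\<lbrakk>f \<in> carrier (free_algebra B); g \<in> carrier (free_algebra B)\<rbrakk>
          \<Longrightarrow> f * g \<in> carrier (free_algebra B)"
proof -
  show add: "f + g \<in> carrier (free_algebra B)"
    if "f \<in> carrier (free_algebra B)" "g \<in> carrier (free_algebra B)" for f g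
    using that Poly_Mapping.keys_add[of f g] unfolding free_algebra_simps by blast
  show neg: "- f \<in> carrier (free_algebra B)" if "f \<in> carrier (free_algebra B)" for f
    using that by (simp add: free_algebra_simps)
  show "f - g \<in> carrier (free_algebra B)"
    if "f \<in> carrier (free_algebra B)" "g \<in> carrier (free_algebra B)" for f g
    using add[OF that(1) neg[OF that(2)]] by simp
  show "f * g \<in> carrier (free_algebra B)"
    if f: "f \<in> carrier (free_algebra B)" and g: "g \<in> carrier (free_algebra B)" for f g
    unfolding free_algebra_simps
  proof
    fix w assume "w \<in> Poly_Mapping.keys (f * g)"
    then obtain u v where "w = u + v" "u \<in> Poly_Mapping.keys f" "v \<in> Poly_Mapping.keys g"
      using Poly_Mapping.keys_mult[of f g] by blast
    with f g show "set (letters w) \<subseteq> B"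
      by (simp add: free_algebra_simps plus_word_def)
  qed
qed (simp_all add: free_algebra_simps zero_word_def)

lemma ring_free_algebra: "ring (free_algebra B)"
proof (rule ringI)
  show "abelian_group (free_algebra B)"
  proof (rule abelian_groupI)
    fix f assume "f \<in> carrier (free_algebra B)"
    then show "\<exists>g \<in> carrier (free_algebra B). g \<oplus>\<^bsub>free_algebra B\<^esub> f = \<zero>\<^bsub>free_algebra B\<^esub>"
      by (intro bexI[of _ "- f"]) (simp_all add: free_algebra_simps(3,5) free_algebra_uminus)
  qed (simp_all add: free_algebra_simps(3,5) free_algebra_closed add_ac)
  show "Group.monoid (free_algebra B)"
    by (rule Group.monoidI)
      (simp_all add: free_algebra_simps(2,4) free_algebra_closed mult.assoc)
qed (simp_all add: free_algebra_simps(2,3) distrib_left distrib_right)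

section \<open>The Lie superalgebra gl(m|n) and its enveloping algebra\<close>

datatype symbol = Virtual nat | Proper nat

definition virtual_symbols :: "nat \<Rightarrow> symbol set"
  where "virtual_symbols m = Virtual ` {1..m}"

definition proper_symbols :: "nat \<Rightarrow> symbol set"
  where "proper_symbols n = Proper ` {1..n}"

definition symbols :: "nat \<Rightarrow> nat \<Rightarrow> symbol set"
  where "symbols m n = virtual_symbols m \<union> proper_symbols n"

text \<open>Parities are used only as exponents of \<open>- 1\<close>, so natural numbers represent
  their classes modulo 2.\<close>

fun parity :: "symbol \<Rightarrow> nat" where
  "parity (Virtual _) = 0"
| "parity (Proper _) = 1"

text \<open>\<open>gen a b\<close> is the basis vector \<open>e\<^sub>a\<^sub>,\<^sub>b\<close>, regarded as an element of degree 1 in the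
  free algebra on the basis, i.e. in the tensor algebra of gl(m|n).\<close>

definition gen :: "symbol \<Rightarrow> symbol \<Rightarrow> (symbol \<times> symbol) word \<Rightarrow>\<^sub>0 complex"
  where "gen a b = Poly_Mapping.single (Word [(a, b)]) 1"

definition super_sign ::
    "symbol \<Rightarrow> symbol \<Rightarrow> symbol \<Rightarrow> symbol \<Rightarrow> (symbol \<times> symbol) word \<Rightarrow>\<^sub>0 complex"
  where "super_sign a b c d = (- 1) ^ ((parity a + parity b) * (parity c + parity d))"

definition superbracket ::
    "symbol \<Rightarrow> symbol \<Rightarrow> symbol \<Rightarrow> symbol \<Rightarrow> (symbol \<times> symbol) word \<Rightarrow>\<^sub>0 complex"
  where "superbracket a b c d =
    (if b = c then gen a d else 0) - super_sign a b c d * (if a = d then gen c b else 0)"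

abbreviation tensor_algebra :: "nat \<Rightarrow> nat \<Rightarrow> ((symbol \<times> symbol) word \<Rightarrow>\<^sub>0 complex) ring"
  where "tensor_algebra m n \<equiv> free_algebra (symbols m n \<times> symbols m n)"

definition enveloping_relations :: "nat \<Rightarrow> nat \<Rightarrow> ((symbol \<times> symbol) word \<Rightarrow>\<^sub>0 complex) set"
  where "enveloping_relations m n =
    {gen a b * gen c d - super_sign a b c d * (gen c d * gen a b) - superbracket a b c d
      | a b c d. {a, b, c, d} \<subseteq> symbols m n}"

definition enveloping_ideal :: "nat \<Rightarrow> nat \<Rightarrow> ((symbol \<times> symbol) word \<Rightarrow>\<^sub>0 complex) set"
  where "enveloping_ideal m n = genideal (tensor_algebra m n) (enveloping_relations m n)"

definition U_super :: "nat \<Rightarrow> nat \<Rightarrow> ((symbol \<times> symbol) word \<Rightarrow>\<^sub>0 complex) set ring"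
  where "U_super m n = tensor_algebra m n Quot enveloping_ideal m n"

definition U_class ::
    "nat \<Rightarrow> nat \<Rightarrow> ((symbol \<times> symbol) word \<Rightarrow>\<^sub>0 complex) \<Rightarrow> ((symbol \<times> symbol) word \<Rightarrow>\<^sub>0 complex) set"
  where "U_class m n f = enveloping_ideal m n +>\<^bsub>tensor_algebra m n\<^esub> f"

lemma gen_in_tensor_algebra:
  assumes "a \<in> symbols m n" "b \<in> symbols m n"
  shows "gen a b \<in> carrier (tensor_algebra m n)"
  using assms by (auto simp: gen_def free_algebra_def)

lemma enveloping_relations_subset:
  "enveloping_relations m n \<subseteq> carrier (tensor_algebra m n)"
proof -
  have sign: "super_sign a b c d \<in> carrier (tensor_algebra m n)" for a b c d
  proof -
    have "(- 1) ^ k \<in> carrier (tensor_algebra m n)" for k :: nat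
      by (induction k) (simp_all add: free_algebra_one free_algebra_uminus)
    then show ?thesis unfolding super_sign_def .
  qed
  have bracket: "superbracket a b c d \<in> carrier (tensor_algebra m n)"
    if "{a, b, c, d} \<subseteq> symbols m n" for a b c d
    unfolding superbracket_def
    using that by (intro free_algebra_diff free_algebra_mult sign)
      (simp_all add: free_algebra_zero gen_in_tensor_algebra)
  show ?thesis
  proof
    fix x assume "x \<in> enveloping_relations m n"
    then obtain a b c d where abcd: "{a, b, c, d} \<subseteq> symbols m n"
      and x: "x = gen a b * gen c d - super_sign a b c d * (gen c d * gen a b)
                - superbracket a b c d"
      unfolding enveloping_relations_def by blast
    show "x \<in> carrier (tensor_algebra m n)"
      unfolding x using abcd
      by (intro free_algebra_diff free_algebra_mult sign bracket gen_in_tensor_algebra) simp_all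
  qed
qed

lemma ideal_enveloping_ideal: "ideal (enveloping_ideal m n) (tensor_algebra m n)"
  unfolding enveloping_ideal_def
  by (intro ring.genideal_ideal ring_free_algebra enveloping_relations_subset)

lemma ring_U_super: "ring (U_super m n)"
  unfolding U_super_def by (intro ideal.quotient_is_ring ideal_enveloping_ideal)

definition U_gen ::
    "nat \<Rightarrow> nat \<Rightarrow> symbol \<Rightarrow> symbol \<Rightarrow> ((symbol \<times> symbol) word \<Rightarrow>\<^sub>0 complex) set"
  where "U_gen m n a b = U_class m n (gen a b)"

definition U_scalar :: "nat \<Rightarrow> nat \<Rightarrow> complex \<Rightarrow> ((symbol \<times> symbol) word \<Rightarrow>\<^sub>0 complex) set"
  where "U_scalar m n c = U_class m n (Poly_Mapping.single 0 c)"

text \<open>\<open>U_prod m n [(a\<^sub>r, b\<^sub>r), \<dots>, (a\<^sub>1, b\<^sub>1)]\<close> is the product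
  \<open>e\<^sub>a\<^sub>r\<^sub>,\<^sub>b\<^sub>r \<cdots> e\<^sub>a\<^sub>1\<^sub>,\<^sub>b\<^sub>1\<close>, in the order of the list.\<close>

definition U_prod ::
    "nat \<Rightarrow> nat \<Rightarrow> (symbol \<times> symbol) list \<Rightarrow> ((symbol \<times> symbol) word \<Rightarrow>\<^sub>0 complex) set"
  where "U_prod m n w =
    foldr (\<lambda>(a, b) x. U_gen m n a b \<otimes>\<^bsub>U_super m n\<^esub> x) w \<one>\<^bsub>U_super m n\<^esub>"

text \<open>A complex subalgebra is a subring containing the scalars.\<close>

definition U_gl :: "nat \<Rightarrow> nat \<Rightarrow> ((symbol \<times> symbol) word \<Rightarrow>\<^sub>0 complex) set ring"
  where "U_gl m n = (U_super m n)
    \<lparr>carrier := generate_ring (U_super m n)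
       (range (U_scalar m n) \<union>
        {U_gen m n i j | i j. i \<in> proper_symbols n \<and> j \<in> proper_symbols n})\<rparr>"

section \<open>Irregular products and devirtualization\<close>

definition left_ideal :: "'a set \<Rightarrow> ('a, 'b) ring_scheme \<Rightarrow> bool"
  where "left_ideal I R \<longleftrightarrow>
    additive_subgroup I R \<and> (\<forall>x \<in> carrier R. \<forall>a \<in> I. x \<otimes>\<^bsub>R\<^esub> a \<in> I)"

definition gen_left_ideal :: "('a, 'b) ring_scheme \<Rightarrow> 'a set \<Rightarrow> 'a set"
  where "gen_left_ideal R A = \<Inter>{I. left_ideal I R \<and> A \<subseteq> I}"

text \<open>Factors are numbered from the right: \<open>rev w ! j\<close>, with \<open>j\<close> starting at \<open>0\<close>, is the pair
  \<open>(a\<^sub>j\<^sub>+\<^sub>1, b\<^sub>j\<^sub>+\<^sub>1)\<close>.\<close>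

definition irregular :: "nat \<Rightarrow> (symbol \<times> symbol) list \<Rightarrow> bool"
  where "irregular m w \<longleftrightarrow>
    (\<exists>i < length w. \<exists>\<gamma> \<in> virtual_symbols m.
       card {j. j \<le> i \<and> snd (rev w ! j) = \<gamma>} > card {j. j < i \<and> fst (rev w ! j) = \<gamma>})"

definition Irr :: "nat \<Rightarrow> nat \<Rightarrow> ((symbol \<times> symbol) word \<Rightarrow>\<^sub>0 complex) set set"
  where "Irr m n = gen_left_ideal (U_super m n)
    {U_prod m n w | w. set w \<subseteq> symbols m n \<times> symbols m n \<and> irregular m w}"

definition Virt :: "nat \<Rightarrow> nat \<Rightarrow> ((symbol \<times> symbol) word \<Rightarrow>\<^sub>0 complex) set set"
  where "Virt m n = carrier (U_gl m n) <+>\<^bsub>U_super m n\<^esub> Irr m n"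

text \<open>The projection of the direct sum \<^term>\<open>Virt m n\<close> onto its first summand.\<close>

definition devirt ::
    "nat \<Rightarrow> nat \<Rightarrow> ((symbol \<times> symbol) word \<Rightarrow>\<^sub>0 complex) set
      \<Rightarrow> ((symbol \<times> symbol) word \<Rightarrow>\<^sub>0 complex) set"
  where "devirt m n = (\<lambda>x \<in> Virt m n.
    THE u. u \<in> carrier (U_gl m n) \<and> (\<exists>v \<in> Irr m n. x = u \<oplus>\<^bsub>U_super m n\<^esub> v))"

section \<open>Capelli bitableaux\<close>

text \<open>A tableau is the list of its rows. The list \<open>\<alpha>s\<close> gives the virtual symbol attached to
  each row; it has as many entries as there are rows.\<close>

definition capelli_bitableau ::
    "nat \<Rightarrow> nat \<Rightarrow> symbol list \<Rightarrow> nat list list \<Rightarrow> nat list list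
      \<Rightarrow> ((symbol \<times> symbol) word \<Rightarrow>\<^sub>0 complex) set"
  where "capelli_bitableau m n \<alpha>s S T = devirt m n (U_prod m n
    (concat (map2 (\<lambda>\<alpha> row. map (\<lambda>s. (Proper s, \<alpha>)) row) \<alpha>s S) @
     concat (map2 (\<lambda>\<alpha> row. map (\<lambda>t. (\<alpha>, Proper t)) row) \<alpha>s T)))"

definition capelli_deruyts ::
    "nat \<Rightarrow> nat \<Rightarrow> symbol list \<Rightarrow> nat \<Rightarrow> ((symbol \<times> symbol) word \<Rightarrow>\<^sub>0 complex) set"
  where "capelli_deruyts m n \<alpha>s p =
    capelli_bitableau m n \<alpha>s (replicate p (rev [1..<Suc n])) (replicate p [1..<Suc n])"

definition center :: "('a, 'b) ring_scheme \<Rightarrow> 'a set"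
  where "center R = {z \<in> carrier R. \<forall>x \<in> carrier R. z \<otimes>\<^bsub>R\<^esub> x = x \<otimes>\<^bsub>R\<^esub> z}"

end

theory Submission
  imports Defs
begin

text \<open>
  Let \<open>W\<close> be the product of generators whose devirtualization is the Capelli-Deruyts bitableau.
  The theorem has two ingredients.

  \<^item> \<open>W\<close> commutes in \<open>U(gl(m|n))\<close> with every proper \<open>e\<^sub>i\<^sub>j\<close>. Bracketing with \<open>e\<^sub>i\<^sub>j\<close> is a derivation,
    and on a row \<open>e\<^sub>n\<^sub>\<alpha> \<cdots> e\<^sub>1\<^sub>\<alpha>\<close> it replaces the factor \<open>e\<^sub>j\<^sub>\<alpha>\<close> by \<open>e\<^sub>i\<^sub>\<alpha>\<close>. The factors of a row anticommute
    and all of \<open>1, \<dots>, n\<close> occur, so for \<open>i \<noteq> j\<close> the result has a repeated factor and vanishes, while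
    for \<open>i = j\<close> it is the row itself. A row \<open>e\<^sub>\<alpha>\<^sub>1 \<cdots> e\<^sub>\<alpha>\<^sub>n\<close> behaves in the same way with the opposite sign.
    In total \<open>[e\<^sub>i\<^sub>j, W] = \<delta>\<^sub>i\<^sub>j (p - p) W = 0\<close>.

  \<^item> Devirtualization transports this to \<open>U(gl(n))\<close>. Write \<open>W = g + v\<close> with \<open>g\<close> proper and \<open>v\<close> in \<open>Irr\<close>.
    The left ideal \<open>Irr\<close> is also closed under right multiplication by \<open>e\<^sub>i\<^sub>j\<close>, because appending a
    proper letter to an irregular word leaves it irregular. Hence \<open>[e\<^sub>i\<^sub>j, g] = - [e\<^sub>i\<^sub>j, v]\<close> lies in
    \<open>U(gl(n)) \<inter> Irr = 0\<close> (\<open>devirt_central\<close>).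

  The second ingredient needs the decomposition \<open>W = g + v\<close> and \<open>U(gl(n)) \<inter> Irr = 0\<close>. Both come from one
  left module. In \<open>gl(m|n)\<close> the \<open>e\<^sub>a\<^sub>i\<close> with \<open>i\<close> proper span a subalgebra \<open>\<pp>\<close>, complementary to the
  subalgebra \<open>\<qq>\<close> spanned by the \<open>e\<^sub>a\<^sub>\<gamma>\<close> with \<open>\<gamma>\<close> virtual, and the module is the one induced from the trivial
  representation of \<open>\<qq>\<close>. By the Poincare-Birkhoff-Witt theorem it is \<open>U(\<pp>)\<close>, but that theorem can
  be avoided: the action \<open>act\<close> is written down on words in the letters of \<open>\<pp>\<close>, moving a letter of \<open>\<qq>\<close> to
  the right through the word by superbrackets until it reaches the empty word and dies. The Jacobi
  identity shows that the relations of \<open>gl(m|n)\<close> hold modulo those of \<open>\<pp>\<close>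
  (\<open>act_defect_in_ideal\<close>, \<open>act_right_proper_ideal\<close>).

  Applying an element \<open>f\<close> to the empty word gives \<open>devirt_rep f\<close>. This fixes proper words; it kills
  irregular words, since no word in the letters of \<open>\<pp>\<close> has negative weight in a virtual symbol
  (\<open>act_along_irregular\<close>); and \<open>f - devirt_rep f\<close> always represents an element of \<open>Irr\<close>
  (\<open>minus_devirt_rep\<close>). If \<open>f\<close> is a balanced word then \<open>devirt_rep f\<close> is proper, which gives the
  decomposition. If \<open>f\<close> is proper and represents an element of \<open>Irr\<close>, then \<open>f = devirt_rep f\<close> vanishes
  modulo the relations of \<open>\<pp>\<close>, and deleting all words with a virtual letter turns these into
  relations of \<open>gl(n)\<close>, so \<open>f\<close> represents \<open>0\<close> (\<open>Irr_proper_zero\<close>).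
\<close>

section \<open>Spans of words and linear maps in free algebras\<close>

definition monomial :: "'a list \<Rightarrow> 'a word \<Rightarrow>\<^sub>0 complex"
  where "monomial w = Poly_Mapping.single (Word w) 1"

abbreviation scal :: "complex \<Rightarrow> 'a word \<Rightarrow>\<^sub>0 complex"
  where "scal c \<equiv> Poly_Mapping.single 0 c"

definition word_span :: "'a list set \<Rightarrow> ('a word \<Rightarrow>\<^sub>0 complex) set"
  where "word_span W = {f. \<forall>w \<in> Poly_Mapping.keys f. letters w \<in> W}"

definition linear_ext ::
    "('a list \<Rightarrow> 'b word \<Rightarrow>\<^sub>0 complex) \<Rightarrow> ('a word \<Rightarrow>\<^sub>0 complex) \<Rightarrow> 'b word \<Rightarrow>\<^sub>0 complex"
  where "linear_ext F f =
    (\<Sum>w \<in> Poly_Mapping.keys f. scal (Poly_Mapping.lookup f w) * F (letters w))"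

lemma monomial_Nil: "monomial [] = 1"
  by (simp add: monomial_def flip: zero_word_def)

lemma monomial_append: "monomial (u @ v) = monomial u * monomial v"
  by (simp add: monomial_def mult_single plus_word_def)

lemma gen_eq_monomial: "gen a b = monomial [(a, b)]"
  by (simp add: gen_def monomial_def)

lemma monomial_Cons: "monomial ((a, b) # w) = gen a b * monomial w"
  by (simp add: gen_eq_monomial flip: monomial_append)

lemma scal_mult: "scal (c * d) = scal c * scal d"
  by (simp add: mult_single)

lemma scal_monomial: "scal c * monomial w = Poly_Mapping.single (Word w) c"
  by (simp add: monomial_def mult_single)

lemma poly_mapping_eq_sum_single:
  "f = (\<Sum>w \<in> Poly_Mapping.keys f. Poly_Mapping.single w (Poly_Mapping.lookup f w))"
  by (rule poly_mapping_eqI)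
    (simp add: lookup_sum lookup_single when_def in_keys_iff sum.delta')

lemma word_span_induct [consumes 1, case_names zero add word]:
  assumes f: "f \<in> word_span W"
    and zero: "P 0" and add: "\<And>f g. P f \<Longrightarrow> P g \<Longrightarrow> P (f + g)"
    and word: "\<And>c w. w \<in> W \<Longrightarrow> P (scal c * monomial w)"
  shows "P f"
proof -
  have "P (\<Sum>w \<in> A. Poly_Mapping.single w (Poly_Mapping.lookup f w))"
    if "finite A" "A \<subseteq> Poly_Mapping.keys f" for A
    using that
  proof (induction A rule: finite_induct)
    case (insert w A)
    have "P (Poly_Mapping.single w (Poly_Mapping.lookup f w))"
      using word[of "letters w" "Poly_Mapping.lookup f w"] f insert.prems
      by (auto simp: word_span_def scal_monomial)
    then show ?case using insert by (simp add: add)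
  qed (simp add: zero)
  from this[of "Poly_Mapping.keys f"] show ?thesis
    by (simp flip: poly_mapping_eq_sum_single)
qed

lemma word_span_UNIV: "f \<in> word_span UNIV"
  by (simp add: word_span_def)

lemma scal_commute: "scal c * f = f * scal c"
  using word_span_UNIV[of f]
  by (induction f rule: word_span_induct)
    (simp_all add: distrib_left distrib_right monomial_def mult_single mult.commute)

lemma scal_left_commute: "f * (scal c * g) = scal c * (f * g)"
  by (metis mult.assoc scal_commute)

lemma free_algebra_eq_word_span: "carrier (free_algebra B) = word_span {w. set w \<subseteq> B}"
  by (simp add: free_algebra_def word_span_def)

lemma word_span_zero: "0 \<in> word_span W"
  by (simp add: word_span_def)

lemma word_span_add: "f \<in> word_span W \<Longrightarrow> g \<in> word_span W \<Longrightarrow> f + g \<in> word_span W"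
  using Poly_Mapping.keys_add[of f g] by (auto simp: word_span_def)

lemma word_span_uminus: "f \<in> word_span W \<Longrightarrow> - f \<in> word_span W"
  by (simp add: word_span_def)

lemma word_span_diff: "f \<in> word_span W \<Longrightarrow> g \<in> word_span W \<Longrightarrow> f - g \<in> word_span W"
  using word_span_add[OF _ word_span_uminus, of f W g] by simp

lemma word_span_monomial: "w \<in> W \<Longrightarrow> monomial w \<in> word_span W"
  by (simp add: word_span_def monomial_def)

lemma word_span_mult:
  assumes "f \<in> word_span V" "g \<in> word_span W" "\<And>v w. v \<in> V \<Longrightarrow> w \<in> W \<Longrightarrow> v @ w \<in> X"
  shows "f * g \<in> word_span X"
  using assms Poly_Mapping.keys_mult[of f g] by (fastforce simp: word_span_def plus_word_def)

lemma word_span_scal: "f \<in> word_span W \<Longrightarrow> scal c * f \<in> word_span W"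
  using word_span_mult[of "scal c" "{[]}" f W W] by (simp add: word_span_def zero_word_def)

lemma word_span_subset: "f \<in> word_span V \<Longrightarrow> V \<subseteq> W \<Longrightarrow> f \<in> word_span W"
  by (auto simp: word_span_def)

lemma word_span_empty: "f \<in> word_span {} \<Longrightarrow> f = 0"
  by (metis (no_types, lifting) empty_iff equals0I keys_eq_empty mem_Collect_eq word_span_def)

lemma linear_ext_eq_sum:
  assumes "finite A" "Poly_Mapping.keys f \<subseteq> A"
  shows "linear_ext F f = (\<Sum>w \<in> A. scal (Poly_Mapping.lookup f w) * F (letters w))"
  unfolding linear_ext_def using assms
  by (intro sum.mono_neutral_left) (auto simp: in_keys_iff)

lemma linear_ext_zero: "linear_ext F 0 = 0"
  by (simp add: linear_ext_def)

lemma linear_ext_add: "linear_ext F (f + g) = linear_ext F f + linear_ext F g"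
proof -
  let ?A = "Poly_Mapping.keys f \<union> Poly_Mapping.keys g"
  have "Poly_Mapping.keys (f + g) \<subseteq> ?A" by (rule Poly_Mapping.keys_add)
  then show ?thesis
    by (simp add: linear_ext_eq_sum[of ?A] lookup_add single_add distrib_right sum.distrib)
qed

lemma linear_ext_uminus: "linear_ext F (- f) = - linear_ext F f"
  by (simp add: linear_ext_def single_uminus sum_negf)

lemma linear_ext_diff: "linear_ext F (f - g) = linear_ext F f - linear_ext F g"
  using linear_ext_add[of F f "- g"] by (simp add: linear_ext_uminus)

lemma linear_ext_monomial: "linear_ext F (monomial w) = F w"
  by (simp add: linear_ext_def monomial_def)

lemma linear_ext_scal: "linear_ext F (scal c * f) = scal c * linear_ext F f"
  using word_span_UNIV[of f]
proof (induction f rule: word_span_induct)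
  case (word d w)
  have single: "linear_ext F (scal e * monomial w) = scal e * F w" for e
    by (simp add: linear_ext_def scal_monomial)
  have "linear_ext F (scal c * (scal d * monomial w)) = linear_ext F (scal (c * d) * monomial w)"
    by (simp only: scal_mult mult.assoc)
  also have "\<dots> = scal c * linear_ext F (scal d * monomial w)"
    unfolding single by (simp only: scal_mult mult.assoc)
  finally show ?case .
qed (simp_all add: linear_ext_zero linear_ext_add distrib_left)

lemmas linear_ext_simps = linear_ext_zero linear_ext_add linear_ext_uminus linear_ext_diff
  linear_ext_monomial linear_ext_scal

lemma linear_ext_word_span:
  assumes "f \<in> word_span V" "\<And>w. w \<in> V \<Longrightarrow> F w \<in> word_span W"
  shows "linear_ext F f \<in> word_span W"
  using assms(1)
  by (induction f rule: word_span_induct)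
    (simp_all add: linear_ext_simps word_span_zero word_span_add word_span_scal assms(2))

section \<open>The induced module on words with proper right indices\<close>

text \<open>The action of \<open>e\<^sub>a\<^sub>b\<close> on the module induced from the trivial representation of \<open>\<qq>\<close>, for words whose
  letters all have a proper right index. A letter of \<open>\<pp>\<close> is prepended; a letter of \<open>\<qq>\<close>
  supercommutes past the first letter and, through the bracket, acts on the remaining word.\<close>

fun act_word :: "symbol \<Rightarrow> symbol \<Rightarrow> (symbol \<times> symbol) list \<Rightarrow> (symbol \<times> symbol) word \<Rightarrow>\<^sub>0 complex"
  where
  "act_word a (Proper j) w = gen a (Proper j) * monomial w"
| "act_word a (Virtual g) [] = 0"
| "act_word a (Virtual g) ((c, d) # w) =
     super_sign a (Virtual g) c d * (gen c d * act_word a (Virtual g) w)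
     + (if Virtual g = c then gen a d * monomial w else 0)
     - super_sign a (Virtual g) c d * (if a = d then act_word c (Virtual g) w else 0)"

definition act :: "symbol \<Rightarrow> symbol \<Rightarrow> ((symbol \<times> symbol) word \<Rightarrow>\<^sub>0 complex) \<Rightarrow> (symbol \<times> symbol) word \<Rightarrow>\<^sub>0 complex"
  where "act a b = linear_ext (act_word a b)"

lemmas act_simps = linear_ext_simps[of "act_word a b" for a b, folded act_def]

lemma super_sign_cases: "super_sign a b c d = 1 \<or> super_sign a b c d = - 1"
  unfolding super_sign_def by (metis minus_one_power_iff)

lemma act_Proper: "act a (Proper j) f = gen a (Proper j) * f"
  using word_span_UNIV[of f]
  by (induction f rule: word_span_induct)
    (simp_all add: act_simps distrib_left scal_left_commute)

lemma act_Virtual_one: "act a (Virtual g) 1 = 0"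
  using act_simps(5)[of a "Virtual g" "[]"] by (simp add: monomial_Nil)

lemma act_Virtual_gen:
  "act a (Virtual g) (gen c d * f) =
     super_sign a (Virtual g) c d * (gen c d * act a (Virtual g) f)
     + (if Virtual g = c then gen a d * f else 0)
     - super_sign a (Virtual g) c d * (if a = d then act c (Virtual g) f else 0)"
  using word_span_UNIV[of f]
proof (induction f rule: word_span_induct)
  case (word k w)
  have "gen c d * (scal k * monomial w) = scal k * monomial ((c, d) # w)"
    by (simp add: monomial_Cons scal_left_commute)
  then show ?case using super_sign_cases[of a "Virtual g" c d]
    by (auto simp: act_simps scal_left_commute algebra_simps)
next
  case (add f h)
  show ?case by (simp add: distrib_left act_simps add algebra_simps)
qed (simp add: act_simps)

definition relator ::
    "symbol \<Rightarrow> symbol \<Rightarrow> symbol \<Rightarrow> symbol \<Rightarrow> (symbol \<times> symbol) word \<Rightarrow>\<^sub>0 complex"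
  where "relator a b c d =
    gen a b * gen c d - super_sign a b c d * (gen c d * gen a b) - superbracket a b c d"

text \<open>The failure of the action to satisfy the defining relation of \<open>U(gl(m|n))\<close> for \<open>e\<^sub>a\<^sub>b\<close> and \<open>e\<^sub>c\<^sub>d\<close>.\<close>

definition act_defect ::
    "symbol \<Rightarrow> symbol \<Rightarrow> symbol \<Rightarrow> symbol \<Rightarrow> ((symbol \<times> symbol) word \<Rightarrow>\<^sub>0 complex)
      \<Rightarrow> (symbol \<times> symbol) word \<Rightarrow>\<^sub>0 complex"
  where "act_defect a b c d f =
    act a b (act c d f) - super_sign a b c d * act c d (act a b f)
    - ((if b = c then act a d f else 0) - super_sign a b c d * (if a = d then act c b f else 0))"

lemma act_defect_Proper_Proper:
  "act_defect a (Proper i) c (Proper j) f = relator a (Proper i) c (Proper j) * f"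
  by (auto simp: act_defect_def relator_def superbracket_def act_Proper algebra_simps)

lemma act_defect_Virtual_Proper: "act_defect a (Virtual g) c (Proper j) f = 0"
  by (simp add: act_defect_def act_Proper act_Virtual_gen)

lemma super_sign_commute: "super_sign c d a b = super_sign a b c d"
  by (simp add: super_sign_def mult.commute)

lemma act_defect_Proper_Virtual: "act_defect a (Proper i) c (Virtual h) f = 0"
  using super_sign_cases[of a "Proper i" c "Virtual h"]
  by (auto simp: act_defect_def act_Proper act_Virtual_gen super_sign_commute[of c])

text \<open>The Jacobi identity for two letters of \<open>\<qq>\<close> and one of \<open>\<pp>\<close>. Terms with a defect between a letter
  of \<open>\<pp>\<close> and one of \<open>\<qq>\<close> do not appear because such defects vanish by the very definition of the
  action.\<close>

lemma act_defect_Virtual_Virtual_gen: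
  "act_defect a (Virtual g) b (Virtual h) (gen c (Proper j) * f) =
    super_sign a (Virtual g) c (Proper j) * super_sign b (Virtual h) c (Proper j)
      * (gen c (Proper j) * act_defect a (Virtual g) b (Virtual h) f)
    - super_sign a (Virtual g) c (Proper j) * super_sign b (Virtual h) c (Proper j)
      * (if a = Proper j then act_defect c (Virtual g) b (Virtual h) f else 0)
    - super_sign b (Virtual h) c (Proper j)
      * (if b = Proper j then act_defect a (Virtual g) c (Virtual h) f else 0)"
  by (cases a; cases b; cases c)
    (simp_all add: act_defect_def act_Proper act_Virtual_gen super_sign_def act_simps algebra_simps)

lemma act_defect_add: "act_defect a b c d (f + g) = act_defect a b c d f + act_defect a b c d g"
  by (simp add: act_defect_def act_simps algebra_simps)

lemma act_defect_scal: "act_defect a b c d (scal k * f) = scal k * act_defect a b c d f"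
  using super_sign_cases[of a b c d]
  by (auto simp: act_defect_def act_simps algebra_simps)

lemma act_defect_Virtual_Virtual:
  assumes "f \<in> word_span {w. snd ` set w \<subseteq> range Proper}"
  shows "act_defect a (Virtual g) b (Virtual h) f = 0"
proof -
  have word: "act_defect a (Virtual g) b (Virtual h) (monomial w) = 0"
    if "snd ` set w \<subseteq> range Proper" for w a b g h
    using that
  proof (induction w arbitrary: a b g h)
    case Nil
    then show ?case by (auto simp: monomial_Nil act_defect_def act_Virtual_one act_simps)
  next
    case (Cons z w)
    obtain c j where "z = (c, Proper j)" using Cons.prems by (cases z) auto
    then show ?case using Cons by (simp add: monomial_Cons act_defect_Virtual_Virtual_gen)
  qed
  from assms show ?thesis
    by (induction f rule: word_span_induct)
      (simp_all add: act_defect_add act_defect_scal word, simp add: act_defect_def act_simps)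
qed

text \<open>The Jacobi identity for one letter of \<open>\<qq>\<close> and two of \<open>\<pp>\<close>: it writes the action on a multiple of a
  relator through multiples of relators, which makes the action descend to \<open>U(\<pp>)\<close>.\<close>

lemma act_Virtual_relator:
  "act a (Virtual g) (relator b (Proper i) c (Proper j) * f) =
    super_sign a (Virtual g) b (Proper i) * super_sign a (Virtual g) c (Proper j)
      * (relator b (Proper i) c (Proper j) * act a (Virtual g) f)
    + super_sign a (Virtual g) b (Proper i)
      * (if Virtual g = c then relator b (Proper i) a (Proper j) * f else 0)
    + (if Virtual g = b then relator a (Proper i) c (Proper j) * f else 0)"
  by (cases a; cases b; cases c)
    (simp_all add: relator_def superbracket_def act_Virtual_gen super_sign_def act_simps algebra_simps)

definition right_proper_words :: "nat \<Rightarrow> nat \<Rightarrow> (symbol \<times> symbol) list set"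
  where "right_proper_words m n = {w. set w \<subseteq> symbols m n \<times> proper_symbols n}"

lemma proper_symbolsE:
  assumes "b \<in> proper_symbols n"
  obtains j where "b = Proper j"
  using assms by (auto simp: proper_symbols_def)

lemma proper_symbols_subset: "proper_symbols n \<subseteq> symbols m n"
  by (simp add: symbols_def)

lemma act_word_right_proper:
  assumes "a \<in> symbols m n" "b \<in> symbols m n" "w \<in> right_proper_words m n"
  shows "act_word a b w \<in> word_span (right_proper_words m n)"
proof -
  have left: "gen c d * f \<in> word_span (right_proper_words m n)"
    if "c \<in> symbols m n" "d \<in> proper_symbols n" "f \<in> word_span (right_proper_words m n)" for c d f
    unfolding gen_eq_monomial using that
    by (intro word_span_mult[OF word_span_monomial[of _ "{[(c, d)]}"]])
      (auto simp: right_proper_words_def)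
  show ?thesis
  proof (cases b)
    case (Proper j)
    then have "b \<in> proper_symbols n"
      using assms(2) by (auto simp: symbols_def virtual_symbols_def)
    then show ?thesis
      using Proper assms left[OF assms(1), of b "monomial w"] by (simp add: word_span_monomial)
  next
    case (Virtual g)
    from assms(1,3) show ?thesis
      unfolding Virtual
    proof (induction w arbitrary: a)
      case Nil
      show ?case by (simp add: word_span_zero)
    next
      case (Cons z w)
      obtain c d where z: "z = (c, d)" by (cases z)
      have mem: "c \<in> symbols m n" "d \<in> proper_symbols n" "w \<in> right_proper_words m n"
        using Cons.prems by (auto simp: z right_proper_words_def)
      show ?case
        using Cons.IH[OF Cons.prems(1) mem(3)] Cons.IH[OF mem(1) mem(3)] mem Cons.prems(1)
          super_sign_cases[of a "Virtual g" c d]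
        by (auto simp: z intro!: word_span_add word_span_diff word_span_uminus left
            word_span_monomial word_span_zero)
    qed
  qed
qed

lemma act_right_proper:
  assumes "a \<in> symbols m n" "b \<in> symbols m n" "f \<in> word_span (right_proper_words m n)"
  shows "act a b f \<in> word_span (right_proper_words m n)"
  unfolding act_def using assms by (auto intro: linear_ext_word_span act_word_right_proper)

text \<open>The relations of \<open>U(\<pp>)\<close>, that is, the two-sided ideal generated by the relators in the free
  algebra on the letters of \<open>\<pp>\<close>.\<close>

inductive_set right_proper_ideal ::
    "nat \<Rightarrow> nat \<Rightarrow> ((symbol \<times> symbol) word \<Rightarrow>\<^sub>0 complex) set" for m n where
  zero: "0 \<in> right_proper_ideal m n"
| add: "f \<in> right_proper_ideal m n \<Longrightarrow> g \<in> right_proper_ideal m n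
    \<Longrightarrow> f + g \<in> right_proper_ideal m n"
| scal: "f \<in> right_proper_ideal m n \<Longrightarrow> scal c * f \<in> right_proper_ideal m n"
| left: "f \<in> right_proper_ideal m n \<Longrightarrow> a \<in> symbols m n \<Longrightarrow> b \<in> proper_symbols n
    \<Longrightarrow> gen a b * f \<in> right_proper_ideal m n"
| relator: "a \<in> symbols m n \<Longrightarrow> b \<in> proper_symbols n \<Longrightarrow> c \<in> symbols m n \<Longrightarrow> d \<in> proper_symbols n
    \<Longrightarrow> f \<in> word_span (right_proper_words m n) \<Longrightarrow> relator a b c d * f \<in> right_proper_ideal m n"

lemma right_proper_ideal_uminus:
  assumes "f \<in> right_proper_ideal m n"
  shows "- f \<in> right_proper_ideal m n"
  using right_proper_ideal.scal[OF assms, of "- 1"] by (simp add: single_uminus)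

lemma right_proper_ideal_diff:
  "f \<in> right_proper_ideal m n \<Longrightarrow> g \<in> right_proper_ideal m n \<Longrightarrow> f - g \<in> right_proper_ideal m n"
  using right_proper_ideal.add[OF _ right_proper_ideal_uminus] by fastforce

lemmas right_proper_ideal_intros = right_proper_ideal.intros right_proper_ideal_uminus
  right_proper_ideal_diff

lemma act_right_proper_ideal:
  assumes "f \<in> right_proper_ideal m n" "a \<in> symbols m n" "b \<in> symbols m n"
  shows "act a b f \<in> right_proper_ideal m n"
proof (cases b)
  case (Proper j)
  then have "b \<in> proper_symbols n"
    using assms(3) by (auto simp: symbols_def virtual_symbols_def)
  then show ?thesis
    using assms right_proper_ideal.left by (simp add: Proper act_Proper)
next
  case (Virtual g)
  from assms(1-3) show ?thesis
    unfolding Virtual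
  proof (induction f arbitrary: a rule: right_proper_ideal.induct)
    case (left f c d)
    have "act a (Virtual g) f \<in> right_proper_ideal m n" "act c (Virtual g) f \<in> right_proper_ideal m n"
      using left by blast+
    then show ?case
      using left.hyps left.prems super_sign_cases[of a "Virtual g" c d]
      by (auto simp: act_Virtual_gen intro!: right_proper_ideal_intros)
  next
    case (relator b i c j f)
    obtain i' j' where ij: "i = Proper i'" "j = Proper j'"
      using relator.hyps by (auto elim!: proper_symbolsE)
    have "act a (Virtual g) f \<in> word_span (right_proper_words m n)"
      using relator by (intro act_right_proper) auto
    then show ?case
      using relator.hyps relator.prems super_sign_cases[of a "Virtual g" b i]
        super_sign_cases[of a "Virtual g" c j]
      unfolding ij
      by (auto simp: act_Virtual_relator intro!: right_proper_ideal_intros)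
  qed (auto simp: act_simps intro: right_proper_ideal_intros)
qed

lemma act_defect_in_ideal:
  assumes "{a, b, c, d} \<subseteq> symbols m n" "f \<in> word_span (right_proper_words m n)"
  shows "act_defect a b c d f \<in> right_proper_ideal m n"
proof (cases b; cases d)
  fix i j assume bd: "b = Proper i" "d = Proper j"
  then have "b \<in> proper_symbols n" "d \<in> proper_symbols n"
    using assms(1) by (auto simp: symbols_def virtual_symbols_def)
  then show ?thesis
    using assms right_proper_ideal.relator[of a m n b c d f]
    by (simp add: bd act_defect_Proper_Proper)
next
  fix g h assume "b = Virtual g" "d = Virtual h"
  moreover have "f \<in> word_span {w. snd ` set w \<subseteq> range Proper}"
    using assms(2) by (rule word_span_subset)
      (auto simp: right_proper_words_def proper_symbols_def)
  ultimately show ?thesis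
    by (simp add: act_defect_Virtual_Virtual right_proper_ideal.zero)
qed (simp_all add: act_defect_Virtual_Proper act_defect_Proper_Virtual right_proper_ideal.zero)

section \<open>The representative of an element in the induced module\<close>

fun act_along ::
    "(symbol \<times> symbol) list \<Rightarrow> ((symbol \<times> symbol) word \<Rightarrow>\<^sub>0 complex)
      \<Rightarrow> (symbol \<times> symbol) word \<Rightarrow>\<^sub>0 complex"
  where
  "act_along [] f = f"
| "act_along ((a, b) # w) f = act a b (act_along w f)"

text \<open>The linear map \<open>f \<mapsto> f \<cdot> 1\<close> from the tensor algebra to the induced module.\<close>

definition devirt_rep ::
    "((symbol \<times> symbol) word \<Rightarrow>\<^sub>0 complex) \<Rightarrow> (symbol \<times> symbol) word \<Rightarrow>\<^sub>0 complex"
  where "devirt_rep = linear_ext (\<lambda>w. act_along w 1)"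

lemmas devirt_rep_simps = linear_ext_simps[of "\<lambda>w. act_along w 1", folded devirt_rep_def]

lemma devirt_rep_one: "devirt_rep 1 = 1"
  using devirt_rep_simps(5)[of "[]"] by (simp add: monomial_Nil)

lemma devirt_rep_gen: "devirt_rep (gen a b * f) = act a b (devirt_rep f)"
  using word_span_UNIV[of f]
proof (induction f rule: word_span_induct)
  case (word c w)
  then show ?case
    by (simp add: devirt_rep_simps act_simps scal_left_commute flip: monomial_Cons)
qed (simp_all add: devirt_rep_simps act_simps distrib_left)

lemma devirt_rep_right_proper:
  assumes "f \<in> carrier (tensor_algebra m n)"
  shows "devirt_rep f \<in> word_span (right_proper_words m n)"
proof -
  have "act_along w 1 \<in> word_span (right_proper_words m n)" if "set w \<subseteq> symbols m n \<times> symbols m n" for w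
    using that
  proof (induction w)
    case Nil
    show ?case using word_span_monomial[of "[]" "right_proper_words m n"]
      by (simp add: monomial_Nil right_proper_words_def)
  next
    case (Cons z w)
    then show ?case by (cases z) (auto intro: act_right_proper)
  qed
  then show ?thesis
    using assms unfolding devirt_rep_def free_algebra_eq_word_span
    by (auto intro: linear_ext_word_span)
qed

lemma devirt_rep_left:
  assumes "u \<in> carrier (tensor_algebra m n)" "devirt_rep f \<in> right_proper_ideal m n"
  shows "devirt_rep (u * f) \<in> right_proper_ideal m n"
  using assms(1) unfolding free_algebra_eq_word_span
proof (induction u rule: word_span_induct)
  case (word c w)
  then have "devirt_rep (monomial w * f) \<in> right_proper_ideal m n"
    by (induction w)
      (auto simp: monomial_Nil monomial_Cons devirt_rep_gen mult.assoc assms(2)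
        intro: act_right_proper_ideal)
  then show ?case
    by (simp add: devirt_rep_simps mult.assoc right_proper_ideal.scal)
qed (simp_all add: devirt_rep_simps distrib_right right_proper_ideal_intros)

lemma devirt_rep_relator:
  assumes "{a, b, c, d} \<subseteq> symbols m n" "v \<in> carrier (tensor_algebra m n)"
  shows "devirt_rep (relator a b c d * v) \<in> right_proper_ideal m n"
proof -
  have "devirt_rep (relator a b c d * v) = act_defect a b c d (devirt_rep v)"
    using super_sign_cases[of a b c d]
    by (auto simp: relator_def superbracket_def act_defect_def devirt_rep_simps devirt_rep_gen
        algebra_simps)
  then show ?thesis
    using act_defect_in_ideal[OF assms(1) devirt_rep_right_proper[OF assms(2)]] by simp
qed

lemma enveloping_relations_eq:
  "enveloping_relations m n = {relator a b c d | a b c d. {a, b, c, d} \<subseteq> symbols m n}"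
  by (simp add: enveloping_relations_def relator_def)

lemma devirt_rep_enveloping_ideal:
  assumes "f \<in> enveloping_ideal m n"
  shows "devirt_rep f \<in> right_proper_ideal m n"
proof -
  let ?T = "tensor_algebra m n"
  \<comment> \<open>Quantifying over right multiples makes \<open>K\<close> two-sided; left multiples are covered by
    \<open>devirt_rep_left\<close>.\<close>
  define K where "K = {f \<in> carrier ?T. \<forall>v \<in> carrier ?T. devirt_rep (f * v) \<in> right_proper_ideal m n}"
  interpret T: ring ?T by (rule ring_free_algebra)
  have "subgroup K (add_monoid ?T)"
  proof (rule T.add.subgroupI)
    have "0 \<in> K"
      by (simp add: K_def free_algebra_zero devirt_rep_simps right_proper_ideal.zero)
    then show "K \<noteq> {}" by blast
    fix f assume f: "f \<in> K"
    have "- f \<oplus>\<^bsub>?T\<^esub> f = \<zero>\<^bsub>?T\<^esub>" by (simp add: free_algebra_simps)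
    then have "\<ominus>\<^bsub>?T\<^esub> f = - f"
      using f T.minus_equality[of "- f" f] free_algebra_uminus[of f] by (simp add: K_def)
    then show "\<ominus>\<^bsub>?T\<^esub> f \<in> K"
      using f by (simp add: K_def free_algebra_uminus devirt_rep_simps right_proper_ideal_uminus)
  qed (auto simp: K_def free_algebra_simps(3) free_algebra_add devirt_rep_simps distrib_right
      right_proper_ideal.add)
  then have "ideal K ?T"
  proof (rule idealI[OF ring_free_algebra])
    fix f u assume "f \<in> K" "u \<in> carrier ?T"
    then show "u \<otimes>\<^bsub>?T\<^esub> f \<in> K" "f \<otimes>\<^bsub>?T\<^esub> u \<in> K"
      by (simp_all add: K_def free_algebra_simps(2) free_algebra_mult mult.assoc devirt_rep_left)
  qed
  moreover have "enveloping_relations m n \<subseteq> K"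
  proof
    fix r assume r: "r \<in> enveloping_relations m n"
    then obtain a b c d where "r = relator a b c d" "{a, b, c, d} \<subseteq> symbols m n"
      unfolding enveloping_relations_eq by blast
    then show "r \<in> K"
      using subsetD[OF enveloping_relations_subset r] by (simp add: K_def devirt_rep_relator)
  qed
  ultimately have "f \<in> K"
    using assms T.genideal_minimal unfolding enveloping_ideal_def by blast
  then show ?thesis
    unfolding K_def using free_algebra_one[of "symbols m n \<times> symbols m n"] by force
qed

section \<open>The proper part of the induced module\<close>

text \<open>A representative of the projection \<open>U(\<pp>) \<rightarrow> U(gl(n))\<close> which sends every \<open>e\<^sub>\<gamma>\<^sub>i\<close> with \<open>\<gamma>\<close> virtual to \<open>0\<close>.\<close>

definition proper_part ::
    "nat \<Rightarrow> ((symbol \<times> symbol) word \<Rightarrow>\<^sub>0 complex) \<Rightarrow> (symbol \<times> symbol) word \<Rightarrow>\<^sub>0 complex"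
  where "proper_part n = linear_ext
    (\<lambda>w. if set w \<subseteq> proper_symbols n \<times> proper_symbols n then monomial w else 0)"

lemmas proper_part_simps = linear_ext_simps
  [of "\<lambda>w. if set w \<subseteq> proper_symbols n \<times> proper_symbols n then monomial w else 0" for n,
    folded proper_part_def]

lemma proper_part_gen:
  "proper_part n (gen a b * f) =
    (if a \<in> proper_symbols n \<and> b \<in> proper_symbols n then gen a b * proper_part n f else 0)"
  using word_span_UNIV[of f]
proof (induction f rule: word_span_induct)
  case (word c w)
  show ?case
    by (simp add: proper_part_simps scal_left_commute flip: monomial_Cons)
qed (simp_all add: proper_part_simps distrib_left)

lemma proper_part_id:
  assumes "f \<in> carrier (free_algebra (proper_symbols n \<times> proper_symbols n))"
  shows "proper_part n f = f"
  using assms unfolding free_algebra_eq_word_span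
  by (induction f rule: word_span_induct) (simp_all add: proper_part_simps)

lemma proper_part_closed:
  "proper_part n f \<in> carrier (tensor_algebra m n)"
  unfolding proper_part_def free_algebra_eq_word_span
  by (rule linear_ext_word_span[OF word_span_UNIV])
    (use proper_symbols_subset[of n m] in \<open>auto intro!: word_span_monomial word_span_zero\<close>)

lemma scal_closed: "scal c \<in> carrier (free_algebra B)"
  by (simp add: free_algebra_simps zero_word_def)

lemma enveloping_ideal_closed:
  shows enveloping_ideal_carrier: "f \<in> enveloping_ideal m n \<Longrightarrow> f \<in> carrier (tensor_algebra m n)"
    and enveloping_ideal_zero: "0 \<in> enveloping_ideal m n"
    and enveloping_ideal_add: "f \<in> enveloping_ideal m n \<Longrightarrow> g \<in> enveloping_ideal m n
          \<Longrightarrow> f + g \<in> enveloping_ideal m n"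
    and enveloping_ideal_left: "f \<in> enveloping_ideal m n \<Longrightarrow> u \<in> carrier (tensor_algebra m n)
          \<Longrightarrow> u * f \<in> enveloping_ideal m n"
    and enveloping_ideal_right: "f \<in> enveloping_ideal m n \<Longrightarrow> u \<in> carrier (tensor_algebra m n)
          \<Longrightarrow> f * u \<in> enveloping_ideal m n"
proof -
  interpret ideal "enveloping_ideal m n" "tensor_algebra m n" by (rule ideal_enveloping_ideal)
  show "f \<in> enveloping_ideal m n \<Longrightarrow> f \<in> carrier (tensor_algebra m n)"
    by (rule a_Hcarr)
  show "0 \<in> enveloping_ideal m n"
    using additive_subgroup.zero_closed[OF additive_subgroup_axioms] by (simp add: free_algebra_simps(5))
  show "f \<in> enveloping_ideal m n \<Longrightarrow> g \<in> enveloping_ideal m n \<Longrightarrow> f + g \<in> enveloping_ideal m n"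
    using additive_subgroup.a_closed[OF additive_subgroup_axioms, of f g] by (simp add: free_algebra_simps(3))
  show "f \<in> enveloping_ideal m n \<Longrightarrow> u \<in> carrier (tensor_algebra m n) \<Longrightarrow> u * f \<in> enveloping_ideal m n"
    using I_l_closed[of f u] by (simp add: free_algebra_simps(2))
  show "f \<in> enveloping_ideal m n \<Longrightarrow> u \<in> carrier (tensor_algebra m n) \<Longrightarrow> f * u \<in> enveloping_ideal m n"
    using I_r_closed[of f u] by (simp add: free_algebra_simps(2))
qed

lemma enveloping_ideal_uminus: "f \<in> enveloping_ideal m n \<Longrightarrow> - f \<in> enveloping_ideal m n"
  using enveloping_ideal_left[of f m n "- 1"] by (simp add: free_algebra_closed)

lemma enveloping_ideal_diff:
  "f \<in> enveloping_ideal m n \<Longrightarrow> g \<in> enveloping_ideal m n \<Longrightarrow> f - g \<in> enveloping_ideal m n"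
  using enveloping_ideal_add[OF _ enveloping_ideal_uminus] by fastforce

lemma relator_in_enveloping_ideal:
  "{a, b, c, d} \<subseteq> symbols m n \<Longrightarrow> relator a b c d \<in> enveloping_ideal m n"
  using ring.genideal_self[OF ring_free_algebra enveloping_relations_subset, of m n]
  unfolding enveloping_ideal_def enveloping_relations_eq by blast

text \<open>If one of the two letters of a relator of \<open>\<pp>\<close> has a virtual left index, then so has every letter
  that occurs in their bracket: a virtual index cannot be contracted with a proper right index.
  Such a relator has proper part \<open>0\<close>, and the other ones are relators of \<open>gl(n)\<close>.\<close>

lemma proper_part_right_proper_ideal:
  assumes "f \<in> right_proper_ideal m n"
  shows "proper_part n f \<in> enveloping_ideal m n"
  using assms
proof (induction f rule: right_proper_ideal.induct)
  case (scal f c)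
  then show ?case by (simp add: proper_part_simps enveloping_ideal_left scal_closed)
next
  case (left f a b)
  then show ?case
    by (auto simp: proper_part_gen enveloping_ideal_zero
        intro!: enveloping_ideal_left gen_in_tensor_algebra subsetD[OF proper_symbols_subset])
next
  case (relator a b c d f)
  show ?case
  proof (cases "a \<in> proper_symbols n \<and> c \<in> proper_symbols n")
    case True
    then have "proper_part n (relator a b c d * f) = relator a b c d * proper_part n f"
      using relator.hyps super_sign_cases[of a b c d]
      by (auto simp: relator_def superbracket_def proper_part_gen proper_part_simps algebra_simps)
    then show ?thesis
      using relator.hyps proper_symbols_subset[of n m]
      by (auto intro!: enveloping_ideal_right relator_in_enveloping_ideal proper_part_closed)
  next
    case False
    then have "proper_part n (relator a b c d * f) = 0"
      using relator.hyps super_sign_cases[of a b c d]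
      by (auto simp: relator_def superbracket_def proper_part_gen proper_part_simps algebra_simps)
    then show ?thesis by (simp add: enveloping_ideal_zero)
  qed
qed (simp_all add: proper_part_simps enveloping_ideal_zero enveloping_ideal_add)

lemma devirt_rep_proper:
  assumes "f \<in> carrier (free_algebra (proper_symbols n \<times> proper_symbols n))"
  shows "devirt_rep f = f"
proof -
  have word: "act_along w 1 = monomial w" if "set w \<subseteq> proper_symbols n \<times> proper_symbols n" for w
    using that by (induction w) (auto simp: monomial_Nil monomial_Cons act_Proper elim!: proper_symbolsE)
  from assms show ?thesis
    unfolding free_algebra_eq_word_span
    by (induction f rule: word_span_induct) (simp_all add: devirt_rep_simps word)
qed

section \<open>Virtual weights\<close>

definition weight_words :: "nat \<Rightarrow> int \<Rightarrow> (symbol \<times> symbol) list set"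
  where "weight_words g k =
    {w. snd ` set w \<subseteq> range Proper \<and> int (count_list (map fst w) (Virtual g)) = k}"

text \<open>The weight of a product with respect to the adjoint action of \<open>e\<^sub>\<gamma>\<^sub>\<gamma>\<close>, where \<open>\<gamma> = Virtual g\<close>. On
  words with proper right indices it counts the occurrences of \<open>\<gamma>\<close>, as in \<^const>\<open>weight_words\<close>.\<close>

definition weight :: "nat \<Rightarrow> (symbol \<times> symbol) list \<Rightarrow> int"
  where "weight g w =
    int (count_list (map fst w) (Virtual g)) - int (count_list (map snd w) (Virtual g))"

lemma gen_weight:
  assumes "f \<in> word_span (weight_words g k)"
  shows "gen a (Proper j) * f \<in> word_span (weight_words g (k + of_bool (a = Virtual g)))"
  unfolding gen_eq_monomial
  by (rule word_span_mult[OF word_span_monomial[of _ "{[(a, Proper j)]}"] assms])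
    (auto simp: weight_words_def)

lemma act_word_weight:
  assumes "w \<in> weight_words g k"
  shows "act_word a b w \<in> word_span (weight_words g (k + weight g [(a, b)]))"
proof (cases b)
  case (Proper j)
  then show ?thesis
    using gen_weight[OF word_span_monomial[OF assms], of a j] by (auto simp: weight_def)
next
  case (Virtual h)
  from assms show ?thesis
    unfolding Virtual
  proof (induction w arbitrary: a k)
    case Nil
    show ?case by (simp add: word_span_zero)
  next
    case (Cons z w)
    obtain c j where z: "z = (c, Proper j)"
      using Cons.prems by (cases z) (auto simp: weight_words_def)
    let ?k = "k - of_bool (c = Virtual g)"
    let ?W = "word_span (weight_words g (k + weight g [(a, Virtual h)]))"
    have w: "w \<in> weight_words g ?k"
      using Cons.prems by (auto simp: z weight_words_def)
    have "gen c (Proper j) * act_word a (Virtual h) w \<in> ?W"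
      using gen_weight[OF Cons.IH[OF w], of c j a] by (simp add: algebra_simps)
    moreover have "gen a (Proper j) * monomial w \<in> ?W" if "Virtual h = c"
      using gen_weight[OF word_span_monomial[OF w], of a j] that
      by (cases "h = g") (auto simp: weight_def algebra_simps)
    moreover have "act_word c (Virtual h) w \<in> ?W" if "a = Proper j"
      using Cons.IH[OF w, of c] that by (auto simp: weight_def algebra_simps of_bool_def split: if_splits)
    ultimately show ?case
      using super_sign_cases[of a "Virtual h" c "Proper j"]
      by (auto simp: z intro!: word_span_add word_span_diff word_span_uminus word_span_zero)
  qed
qed

lemma act_along_weight: "act_along w 1 \<in> word_span (weight_words g (weight g w))"
proof (induction w)
  case Nil
  show ?case using word_span_monomial[of "[]" "weight_words g 0"]
    by (simp add: monomial_Nil weight_words_def weight_def)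
next
  case (Cons z w)
  obtain a b where z: "z = (a, b)" by (cases z)
  have "weight g w + weight g [(a, b)] = weight g (z # w)" by (simp add: weight_def z)
  then show ?case
    using linear_ext_word_span[OF Cons.IH, of "act_word a b"] act_word_weight[of _ g "weight g w" a b]
    by (simp add: z act_def)
qed

text \<open>While \<open>e\<^sub>a\<^sub>\<gamma>\<close> moves through a word without \<open>\<gamma>\<close>, every bracket that arises is again of the form \<open>e\<^sub>c\<^sub>\<gamma>\<close>,
  so all terms end at the empty word. Weights alone do not show this when \<open>a = \<gamma>\<close>.\<close>

lemma act_Virtual_weight_zero:
  assumes "f \<in> word_span (weight_words g 0)"
  shows "act a (Virtual g) f = 0"
proof -
  have word: "act_word a (Virtual g) w = 0" if "w \<in> weight_words g 0" for w
    using that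
  proof (induction w arbitrary: a)
    case (Cons z w)
    then show ?case
      by (cases z) (auto simp: weight_words_def split: if_splits)
  qed simp
  from assms show ?thesis
    by (induction f rule: word_span_induct) (simp_all add: act_simps word)
qed

lemma act_along_append: "act_along (u @ v) f = act_along u (act_along v f)"
  by (induction u f rule: act_along.induct) auto

lemma act_along_zero: "act_along w 0 = 0"
  by (induction w "0 :: (symbol \<times> symbol) word \<Rightarrow>\<^sub>0 complex" rule: act_along.induct) (auto simp: act_simps)

lemma card_nth_eq_count_list:
  assumes "i \<le> length xs"
  shows "card {j. j < i \<and> f (xs ! j) = y} = count_list (map f (take i xs)) y"
proof -
  have "{j. j < i \<and> f (xs ! j) = y} = {j. j < length (take i xs) \<and> f (take i xs ! j) = y}"
    using assms by auto
  then show ?thesis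
    by (simp add: count_list_eq_length_filter filter_map o_def length_filter_conv_card eq_commute)
qed

lemma irregular_iff:
  "irregular m w \<longleftrightarrow> (\<exists>i < length w. \<exists>\<gamma> \<in> virtual_symbols m.
     count_list (map snd (take (Suc i) (rev w))) \<gamma> > count_list (map fst (take i (rev w))) \<gamma>)"
proof -
  have "card {j. j \<le> i \<and> snd (rev w ! j) = \<gamma>} = count_list (map snd (take (Suc i) (rev w))) \<gamma>"
    "card {j. j < i \<and> fst (rev w ! j) = \<gamma>} = count_list (map fst (take i (rev w))) \<gamma>"
    if "i < length w" for i \<gamma>
    using card_nth_eq_count_list[of i "rev w" fst \<gamma>] card_nth_eq_count_list[of "Suc i" "rev w" snd \<gamma>] that
    by (simp_all add: less_Suc_eq_le)
  then show ?thesis unfolding irregular_def by (metis (no_types, lifting))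
qed

text \<open>Irregularity says that, reading from the right, some virtual symbol is removed more often than it
  has been created before, which cannot happen in a module whose virtual weights are nonnegative.\<close>

lemma act_along_irregular:
  assumes "irregular m w"
  shows "act_along w 1 = 0"
proof -
  obtain i g where i: "i < length w"
    and gt: "count_list (map snd (take (Suc i) (rev w))) (Virtual g)
      > count_list (map fst (take i (rev w))) (Virtual g)"
    using assms by (auto simp: irregular_iff virtual_symbols_def)
  obtain a b where ab: "rev w ! i = (a, b)" by (cases "rev w ! i")
  define u where "u = rev (take i (rev w))"
  have step: "take (Suc i) (rev w) = take i (rev w) @ [(a, b)]"
    using i by (simp add: take_Suc_conv_app_nth flip: ab)
  have "rev w = take i (rev w) @ (a, b) # drop (Suc i) (rev w)"
    using i ab by (metis id_take_nth_drop length_rev)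
  then have w: "w = rev (drop (Suc i) (rev w)) @ (a, b) # u"
    unfolding u_def by (metis append.assoc append_Cons append_Nil rev_append rev_rev_ident rev_singleton_conv rev.simps(2))
  from gt have less: "weight g u < of_bool (b = Virtual g)"
    by (auto simp: step weight_def u_def rev_map[symmetric] split: if_splits)
  \<comment> \<open>Just before the offending factor the weight is at most \<open>0\<close>: either it is already negative,
    or it is \<open>0\<close> and that factor removes a \<open>\<gamma>\<close> that is not there.\<close>
  have "act a b (act_along u 1) = 0"
  proof (cases "weight g u < 0")
    case True
    then have "act_along u 1 \<in> word_span {}"
      using act_along_weight[of u g] by (simp add: weight_words_def)
    then show ?thesis using word_span_empty by (fastforce simp: act_simps)
  next
    case False
    then have "b = Virtual g" "weight g u = 0" using less by (auto simp: of_bool_def split: if_splits)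
    then show ?thesis using act_along_weight[of u g] by (simp add: act_Virtual_weight_zero)
  qed
  then show ?thesis
    by (subst w) (simp add: act_along_append act_along_zero)
qed

section \<open>The enveloping algebra as a quotient of the tensor algebra\<close>

lemma U_class_hom:
  shows U_class_closed: "f \<in> carrier (tensor_algebra m n) \<Longrightarrow> U_class m n f \<in> carrier (U_super m n)"
    and U_class_one: "U_class m n 1 = \<one>\<^bsub>U_super m n\<^esub>"
    and U_class_zero: "U_class m n 0 = \<zero>\<^bsub>U_super m n\<^esub>"
    and U_class_add: "f \<in> carrier (tensor_algebra m n) \<Longrightarrow> g \<in> carrier (tensor_algebra m n)
          \<Longrightarrow> U_class m n (f + g) = U_class m n f \<oplus>\<^bsub>U_super m n\<^esub> U_class m n g"
    and U_class_mult: "f \<in> carrier (tensor_algebra m n) \<Longrightarrow> g \<in> carrier (tensor_algebra m n)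
          \<Longrightarrow> U_class m n (f * g) = U_class m n f \<otimes>\<^bsub>U_super m n\<^esub> U_class m n g"
proof -
  interpret ideal "enveloping_ideal m n" "tensor_algebra m n" by (rule ideal_enveloping_ideal)
  interpret hom: ring_hom_ring "tensor_algebra m n" "U_super m n" "U_class m n"
    using rcos_ring_hom_ring unfolding U_super_def U_class_def .
  show "f \<in> carrier (tensor_algebra m n) \<Longrightarrow> U_class m n f \<in> carrier (U_super m n)"
    by (rule hom.hom_closed)
  show "U_class m n 1 = \<one>\<^bsub>U_super m n\<^esub>"
    using hom.hom_one by (simp add: free_algebra_simps(4))
  show "U_class m n 0 = \<zero>\<^bsub>U_super m n\<^esub>"
    using hom.hom_zero by (simp add: free_algebra_simps(5))
  show "f \<in> carrier (tensor_algebra m n) \<Longrightarrow> g \<in> carrier (tensor_algebra m n)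
          \<Longrightarrow> U_class m n (f + g) = U_class m n f \<oplus>\<^bsub>U_super m n\<^esub> U_class m n g"
    using hom.hom_add[of f g] by (simp add: free_algebra_simps(3))
  show "f \<in> carrier (tensor_algebra m n) \<Longrightarrow> g \<in> carrier (tensor_algebra m n)
          \<Longrightarrow> U_class m n (f * g) = U_class m n f \<otimes>\<^bsub>U_super m n\<^esub> U_class m n g"
    using hom.hom_mult[of f g] by (simp add: free_algebra_simps(2))
qed

lemma U_class_uminus:
  assumes "f \<in> carrier (tensor_algebra m n)"
  shows "U_class m n (- f) = \<ominus>\<^bsub>U_super m n\<^esub> U_class m n f"
proof -
  interpret U: ring "U_super m n" by (rule ring_U_super)
  have "U_class m n (- f) \<oplus>\<^bsub>U_super m n\<^esub> U_class m n f = \<zero>\<^bsub>U_super m n\<^esub>"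
    using U_class_add[OF free_algebra_uminus[OF assms] assms] by (simp add: U_class_zero)
  then show ?thesis
    using U.minus_equality assms by (simp add: U_class_closed free_algebra_uminus)
qed

lemma U_class_surj:
  assumes "x \<in> carrier (U_super m n)"
  obtains f where "f \<in> carrier (tensor_algebra m n)" "x = U_class m n f"
  using assms unfolding U_super_def U_class_def FactRing_simps by auto

lemma U_class_eq_zero_iff:
  assumes "f \<in> carrier (tensor_algebra m n)"
  shows "U_class m n f = \<zero>\<^bsub>U_super m n\<^esub> \<longleftrightarrow> f \<in> enveloping_ideal m n"
proof -
  interpret ideal "enveloping_ideal m n" "tensor_algebra m n" by (rule ideal_enveloping_ideal)
  have "enveloping_ideal m n +>\<^bsub>tensor_algebra m n\<^esub> f = enveloping_ideal m n \<longleftrightarrow> f \<in> enveloping_ideal m n"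
    using a_coset_join1[OF _ assms] a_coset_join2[OF assms] a_subgroup
    by (metis a_rcos_const a_rcos_self assms)
  then show ?thesis by (simp add: U_super_def U_class_def FactRing_def)
qed

lemma U_class_eq_iff:
  assumes "f \<in> carrier (tensor_algebra m n)" "g \<in> carrier (tensor_algebra m n)"
  shows "U_class m n f = U_class m n g \<longleftrightarrow> f - g \<in> enveloping_ideal m n"
proof -
  interpret U: ring "U_super m n" by (rule ring_U_super)
  have "U_class m n (f - g) = U_class m n f \<ominus>\<^bsub>U_super m n\<^esub> U_class m n g"
    using U_class_add[of f m n "- g"] assms by (simp add: U_class_uminus free_algebra_uminus U.minus_eq)
  then show ?thesis
    using U_class_eq_zero_iff[of "f - g" m n] assms
    by (metis U.r_right_minus_eq U_class_closed free_algebra_diff)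
qed

lemma monomial_closed: "set w \<subseteq> B \<Longrightarrow> monomial w \<in> carrier (free_algebra B)"
  by (simp add: free_algebra_eq_word_span word_span_monomial)

lemma U_prod_eq: "set w \<subseteq> symbols m n \<times> symbols m n \<Longrightarrow> U_prod m n w = U_class m n (monomial w)"
proof (induction w)
  case Nil
  show ?case by (simp add: U_prod_def monomial_Nil U_class_one)
next
  case (Cons z w)
  then show ?case
    by (cases z)
      (auto simp: monomial_Cons U_class_mult gen_in_tensor_algebra monomial_closed U_gen_def U_prod_def)
qed

abbreviation proper_algebra :: "nat \<Rightarrow> ((symbol \<times> symbol) word \<Rightarrow>\<^sub>0 complex) ring"
  where "proper_algebra n \<equiv> free_algebra (proper_symbols n \<times> proper_symbols n)"

lemma proper_algebra_subset: "f \<in> carrier (proper_algebra n) \<Longrightarrow> f \<in> carrier (tensor_algebra m n)"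
  unfolding free_algebra_simps using proper_symbols_subset[of n m] by blast

lemma gen_in_proper_algebra:
  "a \<in> proper_symbols n \<Longrightarrow> b \<in> proper_symbols n \<Longrightarrow> gen a b \<in> carrier (proper_algebra n)"
  unfolding gen_eq_monomial by (rule monomial_closed) simp

lemma carrier_U_gl: "carrier (U_gl m n) = U_class m n ` carrier (proper_algebra n)"
proof
  show "carrier (U_gl m n) \<subseteq> U_class m n ` carrier (proper_algebra n)"
  proof
    fix x assume "x \<in> carrier (U_gl m n)"
    then have "x \<in> generate_ring (U_super m n) (range (U_scalar m n) \<union>
        {U_gen m n i j | i j. i \<in> proper_symbols n \<and> j \<in> proper_symbols n})"
      by (simp add: U_gl_def)
    then show "x \<in> U_class m n ` carrier (proper_algebra n)"
    proof (induction x rule: generate_ring.induct)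
      case one
      show ?case by (metis U_class_one free_algebra_one imageI)
    next
      case (incl x)
      then show ?case
        by (auto simp: U_scalar_def U_gen_def intro: scal_closed gen_in_proper_algebra)
    next
      case (a_inv x)
      then obtain f where "f \<in> carrier (proper_algebra n)" "x = U_class m n f" by blast
      then show ?case
        by (metis U_class_uminus free_algebra_uminus imageI proper_algebra_subset)
    next
      case (eng_add x y)
      then obtain f g where "f \<in> carrier (proper_algebra n)" "x = U_class m n f"
        "g \<in> carrier (proper_algebra n)" "y = U_class m n g" by blast
      then show ?case
        by (metis U_class_add free_algebra_add imageI proper_algebra_subset)
    next
      case (eng_mult x y)
      then obtain f g where "f \<in> carrier (proper_algebra n)" "x = U_class m n f"
        "g \<in> carrier (proper_algebra n)" "y = U_class m n g" by blast
      then show ?case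
        by (metis U_class_mult free_algebra_mult imageI proper_algebra_subset)
    qed
  qed
  let ?H = "range (U_scalar m n) \<union>
    {U_gen m n i j | i j. i \<in> proper_symbols n \<and> j \<in> proper_symbols n}"
  have "U_class m n f \<in> generate_ring (U_super m n) ?H"
    if "f \<in> word_span {w. set w \<subseteq> proper_symbols n \<times> proper_symbols n}" for f
  proof -
    from that have "f \<in> carrier (proper_algebra n) \<and> U_class m n f \<in> generate_ring (U_super m n) ?H"
    proof (induction f rule: word_span_induct)
      case zero
      have "U_scalar m n 0 \<in> generate_ring (U_super m n) ?H"
        by (rule generate_ring.incl) blast
      then show ?case by (simp add: U_scalar_def free_algebra_zero)
    next
      case (add f g)
      then show ?case
        by (simp add: free_algebra_add U_class_add proper_algebra_subset generate_ring.eng_add)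
    next
      case (word c w)
      have "U_class m n (monomial w) \<in> generate_ring (U_super m n) ?H"
        using word
      proof (induction w)
        case Nil
        show ?case by (simp add: monomial_Nil U_class_one generate_ring.one)
      next
        case (Cons z w)
        obtain a b where z: "z = (a, b)" by (cases z)
        have ab: "a \<in> proper_symbols n" "b \<in> proper_symbols n" using Cons.prems by (auto simp: z)
        then have "U_gen m n a b \<in> generate_ring (U_super m n) ?H"
          by (intro generate_ring.incl) blast
        then show ?case
          using Cons ab generate_ring.eng_mult[of "U_gen m n a b" "U_super m n" ?H]
          by (simp add: z monomial_Cons U_class_mult U_gen_def monomial_closed
              proper_algebra_subset gen_in_proper_algebra)
      qed
      moreover have "U_scalar m n c \<in> generate_ring (U_super m n) ?H"
        by (rule generate_ring.incl) blast
      moreover have "monomial w \<in> carrier (proper_algebra n)"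
        using word by (simp add: monomial_closed)
      ultimately show ?case
        by (simp add: free_algebra_mult scal_closed U_class_mult proper_algebra_subset
            generate_ring.eng_mult U_scalar_def)
    qed
    then show ?thesis by blast
  qed
  then show "U_class m n ` carrier (proper_algebra n) \<subseteq> carrier (U_gl m n)"
    by (auto simp: free_algebra_eq_word_span U_gl_def)
qed

section \<open>The ideal of irregular products and the devirtualization\<close>

lemma left_ideal_Inter:
  assumes "\<And>I. I \<in> F \<Longrightarrow> left_ideal I R" "F \<noteq> {}" "ring R"
  shows "left_ideal (\<Inter>F) R"
proof -
  interpret ring R by fact
  have "subgroup (\<Inter>F) (add_monoid R)"
    using assms(1,2)
    by (intro add.subgroups_Inter) (auto simp: left_ideal_def additive_subgroup_def)
  then show ?thesis
    using assms(1,2) by (auto simp: left_ideal_def additive_subgroup_def)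
qed

lemma left_ideal_carrier: "ring R \<Longrightarrow> left_ideal (carrier R) R"
proof -
  assume "ring R"
  then interpret ring R .
  show ?thesis
    using add.subgroup_self by (simp add: left_ideal_def additive_subgroup_def)
qed

lemma irregular_products_subset:
  "{U_prod m n w | w. set w \<subseteq> symbols m n \<times> symbols m n \<and> irregular m w} \<subseteq> carrier (U_super m n)"
  by (auto simp: U_prod_eq intro!: U_class_closed monomial_closed)

lemma left_ideal_Irr: "left_ideal (Irr m n) (U_super m n)"
proof -
  define A where
    "A = {U_prod m n w | w. set w \<subseteq> symbols m n \<times> symbols m n \<and> irregular m w}"
  have "A \<subseteq> carrier (U_super m n)"
    unfolding A_def by (rule irregular_products_subset)
  then have ne: "{I. left_ideal I (U_super m n) \<and> A \<subseteq> I} \<noteq> {}"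
    using left_ideal_carrier[OF ring_U_super, of m n] by blast
  show ?thesis
    unfolding Irr_def gen_left_ideal_def A_def[symmetric]
    by (rule left_ideal_Inter[OF _ ne ring_U_super]) simp
qed

lemma irregular_in_Irr:
  assumes "set w \<subseteq> symbols m n \<times> symbols m n" "irregular m w"
  shows "U_class m n (monomial w) \<in> Irr m n"
proof -
  have mem: "U_class m n (monomial w)
      \<in> {U_prod m n w | w. set w \<subseteq> symbols m n \<times> symbols m n \<and> irregular m w}"
    using assms by (intro CollectI exI[of _ w]) (simp add: U_prod_eq)
  show ?thesis
    unfolding Irr_def gen_left_ideal_def by (intro InterI) (elim CollectE conjE, erule subsetD[OF _ mem])
qed

lemma Irr_least:
  assumes "left_ideal I (U_super m n)"
    and "\<And>w. set w \<subseteq> symbols m n \<times> symbols m n \<Longrightarrow> irregular m w \<Longrightarrow> U_class m n (monomial w) \<in> I"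
  shows "Irr m n \<subseteq> I"
proof -
  have "{U_prod m n w | w. set w \<subseteq> symbols m n \<times> symbols m n \<and> irregular m w} \<subseteq> I"
    by (rule subsetI, elim CollectE exE conjE) (simp add: U_prod_eq assms(2))
  then show ?thesis
    unfolding Irr_def gen_left_ideal_def using assms(1) by (intro Inter_lower CollectI conjI)
qed

lemma Irr_closed:
  shows Irr_carrier: "x \<in> Irr m n \<Longrightarrow> x \<in> carrier (U_super m n)"
    and Irr_zero: "\<zero>\<^bsub>U_super m n\<^esub> \<in> Irr m n"
    and Irr_add: "x \<in> Irr m n \<Longrightarrow> y \<in> Irr m n \<Longrightarrow> x \<oplus>\<^bsub>U_super m n\<^esub> y \<in> Irr m n"
    and Irr_uminus: "x \<in> Irr m n \<Longrightarrow> \<ominus>\<^bsub>U_super m n\<^esub> x \<in> Irr m n"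
    and Irr_left: "u \<in> carrier (U_super m n) \<Longrightarrow> x \<in> Irr m n \<Longrightarrow> u \<otimes>\<^bsub>U_super m n\<^esub> x \<in> Irr m n"
proof -
  interpret U: ring "U_super m n" by (rule ring_U_super)
  interpret additive_subgroup "Irr m n" "U_super m n"
    using left_ideal_Irr by (simp add: left_ideal_def)
  show "x \<in> Irr m n \<Longrightarrow> x \<in> carrier (U_super m n)" by (rule a_Hcarr)
  show "\<zero>\<^bsub>U_super m n\<^esub> \<in> Irr m n" by (rule zero_closed)
  show "x \<in> Irr m n \<Longrightarrow> y \<in> Irr m n \<Longrightarrow> x \<oplus>\<^bsub>U_super m n\<^esub> y \<in> Irr m n" by (rule a_closed)
  show "x \<in> Irr m n \<Longrightarrow> \<ominus>\<^bsub>U_super m n\<^esub> x \<in> Irr m n"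
    using subgroup.m_inv_closed[OF a_subgroup] by (simp add: a_inv_def)
  show "u \<in> carrier (U_super m n) \<Longrightarrow> x \<in> Irr m n \<Longrightarrow> u \<otimes>\<^bsub>U_super m n\<^esub> x \<in> Irr m n"
    using left_ideal_Irr by (simp add: left_ideal_def)
qed

text \<open>Irregularity counts virtual symbols only, and reads the word from the right, so a proper letter
  at the right end merely shifts the position of the violation by one.\<close>

lemma irregular_append_proper:
  assumes "irregular m w"
  shows "irregular m (w @ [(Proper i, Proper j)])"
proof -
  obtain k \<gamma> where "k < length w" "\<gamma> \<in> virtual_symbols m"
    "count_list (map snd (take (Suc k) (rev w))) \<gamma> > count_list (map fst (take k (rev w))) \<gamma>"
    using assms unfolding irregular_iff by blast
  then show ?thesis
    unfolding irregular_iff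
    by (intro exI[of _ "Suc k"] conjI bexI[of _ \<gamma>]) (auto simp: virtual_symbols_def)
qed

lemma irregular_Virtual: "Virtual g \<in> virtual_symbols m \<Longrightarrow> irregular m [(a, Virtual g)]"
  unfolding irregular_iff by auto

lemma Irr_right_proper:
  assumes "x \<in> Irr m n" "Proper i \<in> proper_symbols n" "Proper j \<in> proper_symbols n"
  shows "x \<otimes>\<^bsub>U_super m n\<^esub> U_class m n (gen (Proper i) (Proper j)) \<in> Irr m n"
proof -
  interpret U: ring "U_super m n" by (rule ring_U_super)
  define e where "e = U_class m n (gen (Proper i) (Proper j))"
  have gen: "gen (Proper i) (Proper j) \<in> carrier (tensor_algebra m n)"
    using assms(2,3) by (intro proper_algebra_subset gen_in_proper_algebra)
  then have e: "e \<in> carrier (U_super m n)" unfolding e_def by (rule U_class_closed)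
  let ?K = "{x \<in> carrier (U_super m n). x \<otimes>\<^bsub>U_super m n\<^esub> e \<in> Irr m n}"
  have "subgroup ?K (add_monoid (U_super m n))"
  proof (rule U.add.subgroupI)
    have "\<zero>\<^bsub>U_super m n\<^esub> \<in> ?K" using e by (simp add: Irr_zero)
    then show "?K \<noteq> {}" by blast
  qed (use e in \<open>auto simp: U.l_minus U.l_distr Irr_uminus Irr_add\<close>)
  then have "left_ideal ?K (U_super m n)"
    using e by (simp add: left_ideal_def additive_subgroup_def U.m_assoc Irr_left)
  moreover have "U_class m n (monomial w) \<in> ?K"
    if "set w \<subseteq> symbols m n \<times> symbols m n" "irregular m w" for w
  proof -
    have "U_class m n (monomial w) \<otimes>\<^bsub>U_super m n\<^esub> e
        = U_class m n (monomial (w @ [(Proper i, Proper j)]))"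
      unfolding e_def using that(1) gen
      by (simp add: U_class_mult monomial_closed monomial_append gen_eq_monomial)
    moreover have "U_class m n (monomial (w @ [(Proper i, Proper j)])) \<in> Irr m n"
      using that assms(2,3) proper_symbols_subset[of n m]
      by (intro irregular_in_Irr irregular_append_proper) auto
    ultimately show ?thesis using that(1) by (simp add: U_class_closed monomial_closed)
  qed
  ultimately have "Irr m n \<subseteq> ?K" by (rule Irr_least)
  then show ?thesis using assms(1) unfolding e_def by blast
qed

lemma Irr_devirt_rep:
  assumes "U_class m n f \<in> Irr m n" "f \<in> carrier (tensor_algebra m n)"
  shows "devirt_rep f \<in> right_proper_ideal m n"
proof -
  interpret U: ring "U_super m n" by (rule ring_U_super)
  \<comment> \<open>A left ideal of the tensor algebra, because \<^const>\<open>devirt_rep\<close> is a module map; its image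
    contains the irregular products.\<close>
  let ?K = "{f \<in> carrier (tensor_algebra m n). devirt_rep f \<in> right_proper_ideal m n}"
  have "subgroup (U_class m n ` ?K) (add_monoid (U_super m n))"
  proof (rule U.add.subgroupI)
    have "0 \<in> ?K" by (simp add: free_algebra_zero devirt_rep_simps right_proper_ideal.zero)
    then show "U_class m n ` ?K \<noteq> {}" by blast
  next
    fix x assume "x \<in> U_class m n ` ?K"
    then obtain f where f: "f \<in> ?K" "x = U_class m n f" by blast
    then have "- f \<in> ?K" by (simp add: free_algebra_uminus devirt_rep_simps right_proper_ideal_uminus)
    then show "\<ominus>\<^bsub>U_super m n\<^esub> x \<in> U_class m n ` ?K"
      using f by (metis (mono_tags, lifting) U_class_uminus imageI mem_Collect_eq)
  next
    fix x y assume "x \<in> U_class m n ` ?K" "y \<in> U_class m n ` ?K"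
    then obtain f g where fg: "f \<in> ?K" "x = U_class m n f" "g \<in> ?K" "y = U_class m n g" by blast
    then have "f + g \<in> ?K" by (simp add: free_algebra_add devirt_rep_simps right_proper_ideal.add)
    then show "x \<oplus>\<^bsub>U_super m n\<^esub> y \<in> U_class m n ` ?K"
      using fg by (metis (mono_tags, lifting) U_class_add imageI mem_Collect_eq)
  qed (auto intro: U_class_closed)
  moreover have "u \<otimes>\<^bsub>U_super m n\<^esub> x \<in> U_class m n ` ?K"
    if u: "u \<in> carrier (U_super m n)" and x: "x \<in> U_class m n ` ?K" for u x
  proof -
    obtain g where g: "g \<in> carrier (tensor_algebra m n)" "u = U_class m n g"
      using u by (rule U_class_surj)
    obtain f where f: "f \<in> ?K" "x = U_class m n f" using x by blast
    then have "g * f \<in> ?K" using g by (simp add: free_algebra_mult devirt_rep_left)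
    then show ?thesis using f g by (metis (mono_tags, lifting) U_class_mult imageI mem_Collect_eq)
  qed
  ultimately have "left_ideal (U_class m n ` ?K) (U_super m n)"
    by (simp add: left_ideal_def additive_subgroup_def)
  moreover have "U_class m n (monomial w) \<in> U_class m n ` ?K"
    if "set w \<subseteq> symbols m n \<times> symbols m n" "irregular m w" for w
    using that
    by (intro imageI) (simp add: monomial_closed devirt_rep_simps act_along_irregular right_proper_ideal.zero)
  ultimately have "Irr m n \<subseteq> U_class m n ` ?K" by (rule Irr_least)
  then obtain g where g: "g \<in> ?K" "U_class m n f = U_class m n g" using assms(1) by blast
  then have "devirt_rep (f - g) \<in> right_proper_ideal m n"
    using assms(2) by (intro devirt_rep_enveloping_ideal) (simp flip: U_class_eq_iff)
  then show ?thesis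
    using g right_proper_ideal.add[of "devirt_rep (f - g)" m n "devirt_rep g"]
    by (simp add: devirt_rep_simps)
qed

text \<open>The intersection \<open>U(gl(n)) \<inter> Irr\<close> is zero: for a proper \<open>f\<close>, both passing to the induced module and
  taking the proper part change nothing, whereas for a representative of an element of \<open>Irr\<close>
  the outcome is a consequence of the relations.\<close>

lemma Irr_proper_zero:
  assumes "f \<in> carrier (proper_algebra n)" "U_class m n f \<in> Irr m n"
  shows "f \<in> enveloping_ideal m n"
  using proper_part_right_proper_ideal[OF Irr_devirt_rep[OF assms(2) proper_algebra_subset[OF assms(1)]]]
  by (simp add: devirt_rep_proper[OF assms(1)] proper_part_id[OF assms(1)])

definition Irr_rep :: "nat \<Rightarrow> nat \<Rightarrow> ((symbol \<times> symbol) word \<Rightarrow>\<^sub>0 complex) set"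
  where "Irr_rep m n = {f \<in> carrier (tensor_algebra m n). U_class m n f \<in> Irr m n}"

lemma Irr_rep_closed:
  shows Irr_rep_zero: "0 \<in> Irr_rep m n"
    and Irr_rep_add: "f \<in> Irr_rep m n \<Longrightarrow> g \<in> Irr_rep m n \<Longrightarrow> f + g \<in> Irr_rep m n"
    and Irr_rep_uminus: "f \<in> Irr_rep m n \<Longrightarrow> - f \<in> Irr_rep m n"
    and Irr_rep_left: "u \<in> carrier (tensor_algebra m n) \<Longrightarrow> f \<in> Irr_rep m n \<Longrightarrow> u * f \<in> Irr_rep m n"
    and Irr_rep_enveloping_ideal: "f \<in> enveloping_ideal m n \<Longrightarrow> f \<in> Irr_rep m n"
  by (auto simp: Irr_rep_def free_algebra_closed U_class_zero U_class_add U_class_uminus U_class_mult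
      Irr_closed U_class_closed enveloping_ideal_carrier)
    (metis Irr_zero U_class_eq_zero_iff enveloping_ideal_carrier)

lemma Irr_rep_diff: "f \<in> Irr_rep m n \<Longrightarrow> g \<in> Irr_rep m n \<Longrightarrow> f - g \<in> Irr_rep m n"
  using Irr_rep_add[OF _ Irr_rep_uminus] by fastforce

lemma Irr_rep_scal: "f \<in> Irr_rep m n \<Longrightarrow> scal c * f \<in> Irr_rep m n"
  by (rule Irr_rep_left[OF scal_closed])

lemma right_proper_closed:
  "f \<in> word_span (right_proper_words m n) \<Longrightarrow> f \<in> carrier (tensor_algebra m n)"
  unfolding free_algebra_eq_word_span right_proper_words_def
  using proper_symbols_subset[of n m] by (elim word_span_subset) blast

text \<open>Modulo \<open>Irr\<close>, multiplication by \<open>e\<^sub>a\<^sub>b\<close> is the action on the induced module: the rules that move \<open>e\<^sub>a\<^sub>\<gamma>\<close>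
  to the right are relations of \<open>U(gl(m|n))\<close>, and \<open>e\<^sub>a\<^sub>\<gamma>\<close> by itself is an irregular product.\<close>

lemma gen_minus_act_word:
  assumes "w \<in> right_proper_words m n" "a \<in> symbols m n" "b \<in> symbols m n"
  shows "gen a b * monomial w - act_word a b w \<in> Irr_rep m n"
proof (cases b)
  case (Proper j)
  then show ?thesis by (simp add: Irr_rep_zero)
next
  case (Virtual g)
  from assms(1-3) show ?thesis
    unfolding Virtual
  proof (induction w arbitrary: a)
    case Nil
    then have "Virtual g \<in> virtual_symbols m" by (auto simp: symbols_def proper_symbols_def)
    then have "U_class m n (monomial [(a, Virtual g)]) \<in> Irr m n"
      using Nil by (intro irregular_in_Irr irregular_Virtual) auto
    then show ?case
      using Nil by (simp add: Irr_rep_def monomial_Nil gen_in_tensor_algebra flip: gen_eq_monomial)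
  next
    case (Cons z w)
    obtain c d where z: "z = (c, d)" by (cases z)
    have mem: "c \<in> symbols m n" "d \<in> symbols m n" "d \<in> proper_symbols n" "w \<in> right_proper_words m n"
      using Cons.prems proper_symbols_subset[of n m] by (auto simp: z right_proper_words_def)
    have w: "monomial w \<in> carrier (tensor_algebra m n)"
      using mem by (intro right_proper_closed word_span_monomial)
    define X where "X x = gen x (Virtual g) * monomial w - act_word x (Virtual g) w" for x
    have X: "X x \<in> Irr_rep m n" if "x \<in> symbols m n" for x
      unfolding X_def using Cons that mem by blast
    have rel: "relator a (Virtual g) c d * monomial w \<in> Irr_rep m n"
      using Cons.prems mem w
      by (intro Irr_rep_enveloping_ideal enveloping_ideal_right relator_in_enveloping_ideal) auto
    have "gen a (Virtual g) * monomial (z # w) - act_word a (Virtual g) (z # w)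
      = relator a (Virtual g) c d * monomial w + super_sign a (Virtual g) c d * (gen c d * X a)
        - super_sign a (Virtual g) c d * (if a = d then X c else 0)"
      unfolding X_def using super_sign_cases[of a "Virtual g" c d]
      by (auto simp: z monomial_Cons relator_def superbracket_def algebra_simps)
    moreover have "gen c d * X a \<in> Irr_rep m n"
      using X Cons.prems mem by (intro Irr_rep_left gen_in_tensor_algebra) auto
    ultimately show ?case
      using rel X mem super_sign_cases[of a "Virtual g" c d]
      by (auto intro!: Irr_rep_add Irr_rep_diff Irr_rep_uminus Irr_rep_zero)
  qed
qed

lemma gen_minus_act:
  assumes "f \<in> word_span (right_proper_words m n)" "a \<in> symbols m n" "b \<in> symbols m n"
  shows "gen a b * f - act a b f \<in> Irr_rep m n"
  using assms(1)
proof (induction f rule: word_span_induct)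
  case (add f g)
  then show ?case using Irr_rep_add[OF add] by (simp add: act_simps algebra_simps)
next
  case (word c w)
  then show ?case
    using Irr_rep_scal[OF gen_minus_act_word[OF word assms(2,3)], of c]
    by (simp add: act_simps scal_left_commute algebra_simps)
qed (simp add: act_simps Irr_rep_zero)

lemma minus_devirt_rep:
  assumes "set w \<subseteq> symbols m n \<times> symbols m n"
  shows "monomial w - devirt_rep (monomial w) \<in> Irr_rep m n"
  using assms
proof (induction w)
  case Nil
  show ?case by (simp add: monomial_Nil devirt_rep_one Irr_rep_zero)
next
  case (Cons z w)
  obtain a b where z: "z = (a, b)" by (cases z)
  have mem: "a \<in> symbols m n" "b \<in> symbols m n" "set w \<subseteq> symbols m n \<times> symbols m n"
    using Cons.prems by (auto simp: z)
  let ?d = "devirt_rep (monomial w)"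
  have "monomial (z # w) - devirt_rep (monomial (z # w))
      = gen a b * (monomial w - ?d) + (gen a b * ?d - act a b ?d)"
    by (simp add: z monomial_Cons devirt_rep_gen algebra_simps)
  then show ?case
    using Cons.IH mem
    by (simp add: Irr_rep_add Irr_rep_left gen_in_tensor_algebra gen_minus_act
        devirt_rep_right_proper monomial_closed)
qed

text \<open>In a word with proper right indices, weight \<open>0\<close> in a virtual symbol means that the symbol does not
  occur.\<close>

lemma devirt_rep_balanced:
  assumes "set w \<subseteq> symbols m n \<times> symbols m n"
    and "\<And>g. Virtual g \<in> virtual_symbols m \<Longrightarrow> weight g w = 0"
  shows "devirt_rep (monomial w) \<in> carrier (proper_algebra n)"
  unfolding free_algebra_simps
proof (intro ballI subrelI)
  fix v a b assume v: "v \<in> Poly_Mapping.keys (devirt_rep (monomial w))" and ab: "(a, b) \<in> set (letters v)"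
  have "letters v \<in> right_proper_words m n"
    using v devirt_rep_right_proper[OF monomial_closed[OF assms(1)]] by (simp add: word_span_def)
  then have mem: "a \<in> symbols m n" "b \<in> proper_symbols n"
    using ab by (auto simp: right_proper_words_def)
  have "a \<notin> virtual_symbols m"
  proof
    assume a: "a \<in> virtual_symbols m"
    then obtain g where g: "a = Virtual g" by (auto simp: virtual_symbols_def)
    have "letters v \<in> weight_words g 0"
      using v act_along_weight[of w g] assms(2)[of g] a g by (simp add: word_span_def devirt_rep_simps)
    then have "count_list (map fst (letters v)) (Virtual g) = 0" by (simp add: weight_words_def)
    then show False using ab g by (force simp: count_list_0_iff)
  qed
  then show "(a, b) \<in> proper_symbols n \<times> proper_symbols n"
    using mem by (simp add: symbols_def)
qed

lemma devirt_eq: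
  assumes "u \<in> carrier (U_gl m n)" "v \<in> Irr m n"
  shows "devirt m n (u \<oplus>\<^bsub>U_super m n\<^esub> v) = u"
proof -
  interpret U: ring "U_super m n" by (rule ring_U_super)
  let ?x = "u \<oplus>\<^bsub>U_super m n\<^esub> v"
  have "?x \<in> Virt m n" unfolding Virt_def set_add_def' using assms by blast
  have "u' = u"
    if u': "u' \<in> carrier (U_gl m n)" "v' \<in> Irr m n" "?x = u' \<oplus>\<^bsub>U_super m n\<^esub> v'" for u' v'
  proof -
    obtain f f' where f: "f \<in> carrier (proper_algebra n)" "u = U_class m n f"
      "f' \<in> carrier (proper_algebra n)" "u' = U_class m n f'"
      using assms(1) u'(1) unfolding carrier_U_gl by blast
    then have mem: "f \<in> carrier (tensor_algebra m n)" "f' \<in> carrier (tensor_algebra m n)"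
      by (simp_all add: proper_algebra_subset)
    then have U: "u \<in> carrier (U_super m n)" "u' \<in> carrier (U_super m n)"
      using f by (simp_all add: U_class_closed)
    have V: "v \<in> carrier (U_super m n)" "v' \<in> carrier (U_super m n)"
      using assms(2) u'(2) by (simp_all add: Irr_carrier)
    have "u' \<ominus>\<^bsub>U_super m n\<^esub> u = v \<ominus>\<^bsub>U_super m n\<^esub> v'"
      using u'(3) U V
      by (smt (verit) U.a_assoc U.a_comm U.a_closed U.add.inv_closed U.minus_eq U.r_neg U.r_zero U.l_zero)
    moreover have "u' \<ominus>\<^bsub>U_super m n\<^esub> u = U_class m n (f' - f)"
      using f mem U_class_add[of f' m n "- f"]
      by (simp add: U_class_uminus free_algebra_uminus U.minus_eq)
    ultimately have "U_class m n (f' - f) \<in> Irr m n"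
      using Irr_add[OF assms(2) Irr_uminus[OF u'(2)]] by (simp add: U.minus_eq)
    then have "f' - f \<in> enveloping_ideal m n"
      using f by (intro Irr_proper_zero free_algebra_diff)
    then show ?thesis using f mem by (simp add: U_class_eq_iff)
  qed
  then have "(THE u. u \<in> carrier (U_gl m n) \<and> (\<exists>v \<in> Irr m n. ?x = u \<oplus>\<^bsub>U_super m n\<^esub> v)) = u"
    using assms by (intro the_equality conjI) (blast, blast, metis)
  with \<open>?x \<in> Virt m n\<close> show ?thesis
    unfolding devirt_def by simp
qed

section \<open>Rows as eigenvectors of the adjoint action\<close>

text \<open>Modulo the relations, \<open>f\<close> is an eigenvector of the adjoint action of \<open>e\<close> with eigenvalue \<open>c\<close>.\<close>

definition ad_eigen ::
    "nat \<Rightarrow> nat \<Rightarrow> ((symbol \<times> symbol) word \<Rightarrow>\<^sub>0 complex) \<Rightarrow> complex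
      \<Rightarrow> ((symbol \<times> symbol) word \<Rightarrow>\<^sub>0 complex) \<Rightarrow> bool"
  where "ad_eigen m n e c f \<longleftrightarrow>
    f \<in> carrier (tensor_algebra m n) \<and> e * f - f * e - scal c * f \<in> enveloping_ideal m n"

lemma ad_eigen_one: "ad_eigen m n e 0 1"
  by (simp add: ad_eigen_def free_algebra_one enveloping_ideal_zero)

lemma ad_eigen_mult:
  assumes "ad_eigen m n e c f" "ad_eigen m n e d g"
  shows "ad_eigen m n e (c + d) (f * g)"
proof -
  have "e * (f * g) - f * g * e - scal (c + d) * (f * g)
      = (e * f - f * e - scal c * f) * g + f * (e * g - g * e - scal d * g)"
    by (simp add: algebra_simps single_add scal_left_commute)
  also have "\<dots> \<in> enveloping_ideal m n"
    using assms unfolding ad_eigen_def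
    by (intro enveloping_ideal_add enveloping_ideal_left enveloping_ideal_right) auto
  finally show ?thesis using assms by (simp add: ad_eigen_def free_algebra_mult)
qed

lemma ad_eigen_prod_list:
  assumes "\<And>x. x \<in> set xs \<Longrightarrow> ad_eigen m n e c (f x)"
  shows "ad_eigen m n e (of_nat (length xs) * c) (prod_list (map f xs))"
  using assms
proof (induction xs)
  case (Cons x xs)
  then show ?case
    using ad_eigen_mult[of m n e c "f x" "of_nat (length xs) * c" "prod_list (map f xs)"]
    by (simp add: algebra_simps)
qed (simp add: ad_eigen_one)

text \<open>The situation common to the rows of \<open>S\<close> and of \<open>T\<close>: the factors anticommute, and bracketing with \<open>e\<close>
  sends \<open>y\<^sub>u\<close> to \<open>c y\<^sub>v\<close> and every other factor to \<open>0\<close>.\<close>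

locale anticommuting_family =
  fixes m n :: nat and e :: "(symbol \<times> symbol) word \<Rightarrow>\<^sub>0 complex" and c :: complex
    and y :: "nat \<Rightarrow> (symbol \<times> symbol) word \<Rightarrow>\<^sub>0 complex" and K :: "nat set" and u v :: nat
  assumes e_closed: "e \<in> carrier (tensor_algebra m n)"
    and y_closed: "s \<in> K \<Longrightarrow> y s \<in> carrier (tensor_algebra m n)"
    and v_in: "v \<in> K"
    and anticommute: "s \<in> K \<Longrightarrow> t \<in> K \<Longrightarrow> y s * y t + y t * y s \<in> enveloping_ideal m n"
    and bracket: "s \<in> K \<Longrightarrow>
      e * y s - y s * e - (if s = u then scal c * y v else 0) \<in> enveloping_ideal m n"
begin

abbreviation row :: "nat list \<Rightarrow> (symbol \<times> symbol) word \<Rightarrow>\<^sub>0 complex"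
  where "row ss \<equiv> prod_list (map y ss)"

lemma row_closed: "set ss \<subseteq> K \<Longrightarrow> row ss \<in> carrier (tensor_algebra m n)"
  by (induction ss) (auto simp: free_algebra_one intro!: free_algebra_mult y_closed)

lemma square_zero: "y v * y v \<in> enveloping_ideal m n"
proof -
  have "scal (1 / 2) * (y v * y v + y v * y v) = scal (1 / 2 + 1 / 2) * (y v * y v)"
    unfolding single_add by (simp add: algebra_simps)
  then show ?thesis
    using enveloping_ideal_left[OF anticommute[OF v_in v_in] scal_closed, of "1 / 2"] by simp
qed

lemma repeated_factor_zero:
  assumes "set ss \<subseteq> K" "v \<in> set ss"
  shows "y v * row ss \<in> enveloping_ideal m n"
  using assms
proof (induction ss)
  case (Cons s ss)
  then have s: "s \<in> K" and ss: "row ss \<in> carrier (tensor_algebra m n)" by (auto intro: row_closed)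
  show ?case
  proof (cases "s = v")
    case True
    then show ?thesis
      using enveloping_ideal_right[OF square_zero ss] by (simp add: mult.assoc)
  next
    case False
    have "y v * row (s # ss) = (y v * y s + y s * y v) * row ss - y s * (y v * row ss)"
      by (simp add: algebra_simps)
    also have "\<dots> \<in> enveloping_ideal m n"
      using Cons False
      by (intro enveloping_ideal_diff enveloping_ideal_right[OF anticommute[OF v_in s] ss]
          enveloping_ideal_left[OF _ y_closed[OF s]]) auto
    finally show ?thesis .
  qed
qed simp

text \<open>Bracketing with \<open>e\<close> turns \<open>y\<^sub>u\<close> into a multiple of \<open>y\<^sub>v\<close>, and \<open>y\<^sub>v\<close> on the left then meets a second \<open>y\<^sub>v\<close>. In
  \<open>row_commutator_zero\<close> this covers the case where \<open>y\<^sub>v\<close> stands to the left of \<open>y\<^sub>u\<close>.\<close>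

lemma left_mult_commutator_zero:
  assumes "set ss \<subseteq> K"
  shows "y v * (e * row ss - row ss * e) \<in> enveloping_ideal m n"
  using assms
proof (induction ss)
  case Nil
  show ?case by (simp add: enveloping_ideal_zero)
next
  case (Cons s ss)
  then have s: "s \<in> K" and ss: "row ss \<in> carrier (tensor_algebra m n)" by (auto intro: row_closed)
  let ?d = "if s = u then scal c * y v else 0"
  have comm: "e * row ss - row ss * e \<in> carrier (tensor_algebra m n)"
    using ss e_closed by (intro free_algebra_diff free_algebra_mult)
  have "y v * (e * row (s # ss) - row (s # ss) * e)
      = y v * ((e * y s - y s * e - ?d) * row ss)
        + (if s = u then scal c * (y v * y v * row ss) else 0)
        + (y v * y s + y s * y v) * (e * row ss - row ss * e)
        - y s * (y v * (e * row ss - row ss * e))"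
    by (simp add: algebra_simps scal_left_commute)
  also have "\<dots> \<in> enveloping_ideal m n"
    using Cons.IH Cons.prems
      enveloping_ideal_left[OF enveloping_ideal_right[OF bracket[OF s] ss] y_closed[OF v_in]]
      enveloping_ideal_left[OF enveloping_ideal_right[OF square_zero ss] scal_closed, of c]
      enveloping_ideal_right[OF anticommute[OF v_in s] comm]
    by (intro enveloping_ideal_diff enveloping_ideal_add enveloping_ideal_left[OF _ y_closed[OF s]])
      (auto simp: enveloping_ideal_zero)
  finally show ?case .
qed

lemma row_commutator_zero:
  assumes "set ss \<subseteq> K" "v \<in> set ss" "u \<noteq> v"
  shows "e * row ss - row ss * e \<in> enveloping_ideal m n"
  using assms(1,2)
proof (induction ss)
  case (Cons s ss)
  then have s: "s \<in> K" and ss: "row ss \<in> carrier (tensor_algebra m n)" by (auto intro: row_closed)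
  let ?d = "if s = u then scal c * y v else 0"
  have "e * row (s # ss) - row (s # ss) * e
      = (e * y s - y s * e - ?d) * row ss + (if s = u then scal c * (y v * row ss) else 0)
        + y s * (e * row ss - row ss * e)"
    by (simp add: algebra_simps)
  also have "\<dots> \<in> enveloping_ideal m n"
  proof (intro enveloping_ideal_add)
    show "(e * y s - y s * e - ?d) * row ss \<in> enveloping_ideal m n"
      by (rule enveloping_ideal_right[OF bracket[OF s] ss])
    show "(if s = u then scal c * (y v * row ss) else 0) \<in> enveloping_ideal m n"
      using enveloping_ideal_left[OF repeated_factor_zero[of ss] scal_closed, of c] Cons.prems assms(3)
      by (auto simp: enveloping_ideal_zero)
    show "y s * (e * row ss - row ss * e) \<in> enveloping_ideal m n"
    proof (cases "s = v")
      case True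
      then show ?thesis using left_mult_commutator_zero Cons.prems by simp
    next
      case False
      then show ?thesis using Cons s by (intro enveloping_ideal_left y_closed) auto
    qed
  qed
  finally show ?case .
qed simp

lemma row_commutator_count:
  assumes "set ss \<subseteq> K" "u = v"
  shows "ad_eigen m n e (of_nat (count_list ss v) * c) (row ss)"
  using assms(1)
proof (induction ss)
  case (Cons s ss)
  have "ad_eigen m n e (if s = v then c else 0) (y s)"
    using bracket[of s] y_closed[of s] Cons.prems assms(2) by (auto simp: ad_eigen_def)
  then have "ad_eigen m n e ((if s = v then c else 0) + of_nat (count_list ss v) * c) (y s * row ss)"
    using Cons by (intro ad_eigen_mult) auto
  then show ?case by (auto simp: algebra_simps)
qed (simp add: ad_eigen_one)

lemma ad_eigen_row:
  assumes "set ss = K" "distinct ss"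
  shows "ad_eigen m n e (if u = v then c else 0) (row ss)"
proof (cases "u = v")
  case True
  moreover have "count_list ss v = 1"
    using assms(2) v_in unfolding assms(1)[symmetric] by (induction ss) auto
  ultimately show ?thesis using row_commutator_count[of ss] assms(1) by simp
next
  case False
  then show ?thesis
    using row_commutator_zero[of ss] assms(1) v_in row_closed by (simp add: ad_eigen_def)
qed

end

lemma monomial_map: "monomial (map (\<lambda>s. (f s, g s)) ss) = prod_list (map (\<lambda>s. gen (f s) (g s)) ss)"
  by (induction ss) (simp_all add: monomial_Nil monomial_Cons)

lemma monomial_concat: "monomial (concat ws) = prod_list (map monomial ws)"
  by (induction ws) (simp_all add: monomial_Nil monomial_append)

lemma ad_eigen_annihilating_row:
  assumes "\<alpha> \<in> virtual_symbols m" "i \<in> {1..n}" "j \<in> {1..n}" "set ss = {1..n}" "distinct ss"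
  shows "ad_eigen m n (gen (Proper i) (Proper j)) (if j = i then 1 else 0)
    (monomial (map (\<lambda>s. (Proper s, \<alpha>)) ss))"
proof -
  obtain g where \<alpha>: "\<alpha> = Virtual g" using assms(1) by (auto simp: virtual_symbols_def)
  have sym: "\<alpha> \<in> symbols m n" "\<And>s. s \<in> {1..n} \<Longrightarrow> Proper s \<in> symbols m n"
    using assms(1) by (auto simp: symbols_def proper_symbols_def)
  interpret anticommuting_family m n "gen (Proper i) (Proper j)" 1 "\<lambda>s. gen (Proper s) \<alpha>" "{1..n}" j i
  proof
    show "gen (Proper i) (Proper j) \<in> carrier (tensor_algebra m n)"
      using sym assms by (simp add: gen_in_tensor_algebra)
    show "gen (Proper s) \<alpha> \<in> carrier (tensor_algebra m n)" if "s \<in> {1..n}" for s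
      using sym that by (simp add: gen_in_tensor_algebra)
    show "gen (Proper s) \<alpha> * gen (Proper t) \<alpha> + gen (Proper t) \<alpha> * gen (Proper s) \<alpha>
        \<in> enveloping_ideal m n" if "s \<in> {1..n}" "t \<in> {1..n}" for s t
      using relator_in_enveloping_ideal[of "Proper s" \<alpha> "Proper t" \<alpha> m n] sym that
      by (simp add: \<alpha> relator_def superbracket_def super_sign_def)
    show "gen (Proper i) (Proper j) * gen (Proper s) \<alpha> - gen (Proper s) \<alpha> * gen (Proper i) (Proper j)
        - (if s = j then scal 1 * gen (Proper i) \<alpha> else 0) \<in> enveloping_ideal m n"
      if "s \<in> {1..n}" for s
      using relator_in_enveloping_ideal[of "Proper i" "Proper j" "Proper s" \<alpha> m n] sym that assms
      by (auto simp: \<alpha> relator_def superbracket_def super_sign_def)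
  qed (fact assms(2))
  show ?thesis using ad_eigen_row[OF assms(4,5)] by (simp add: monomial_map)
qed

lemma ad_eigen_creating_row:
  assumes "\<alpha> \<in> virtual_symbols m" "i \<in> {1..n}" "j \<in> {1..n}" "set ts = {1..n}" "distinct ts"
  shows "ad_eigen m n (gen (Proper i) (Proper j)) (if j = i then - 1 else 0)
    (monomial (map (\<lambda>t. (\<alpha>, Proper t)) ts))"
proof -
  obtain g where \<alpha>: "\<alpha> = Virtual g" using assms(1) by (auto simp: virtual_symbols_def)
  have sym: "\<alpha> \<in> symbols m n" "\<And>s. s \<in> {1..n} \<Longrightarrow> Proper s \<in> symbols m n"
    using assms(1) by (auto simp: symbols_def proper_symbols_def)
  interpret anticommuting_family m n "gen (Proper i) (Proper j)" "- 1" "\<lambda>t. gen \<alpha> (Proper t)" "{1..n}" i j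
  proof
    show "gen (Proper i) (Proper j) \<in> carrier (tensor_algebra m n)"
      using sym assms by (simp add: gen_in_tensor_algebra)
    show "gen \<alpha> (Proper s) \<in> carrier (tensor_algebra m n)" if "s \<in> {1..n}" for s
      using sym that by (simp add: gen_in_tensor_algebra)
    show "gen \<alpha> (Proper s) * gen \<alpha> (Proper t) + gen \<alpha> (Proper t) * gen \<alpha> (Proper s)
        \<in> enveloping_ideal m n" if "s \<in> {1..n}" "t \<in> {1..n}" for s t
      using relator_in_enveloping_ideal[of \<alpha> "Proper s" \<alpha> "Proper t" m n] sym that
      by (simp add: \<alpha> relator_def superbracket_def super_sign_def)
    show "gen (Proper i) (Proper j) * gen \<alpha> (Proper s) - gen \<alpha> (Proper s) * gen (Proper i) (Proper j)
        - (if s = i then scal (- 1) * gen \<alpha> (Proper j) else 0) \<in> enveloping_ideal m n"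
      if "s \<in> {1..n}" for s
      using relator_in_enveloping_ideal[of "Proper i" "Proper j" \<alpha> "Proper s" m n] sym that assms
      by (auto simp: \<alpha> relator_def superbracket_def super_sign_def single_uminus)
  qed (fact assms(3))
  show ?thesis using ad_eigen_row[OF assms(4,5)] by (auto simp: monomial_map)
qed

section \<open>Centrality\<close>

lemma commutes_with_U_gl:
  assumes "g \<in> carrier (tensor_algebra m n)" "f \<in> carrier (proper_algebra n)"
    and gens: "\<And>i j. i \<in> {1..n} \<Longrightarrow> j \<in> {1..n} \<Longrightarrow>
      gen (Proper i) (Proper j) * g - g * gen (Proper i) (Proper j) \<in> enveloping_ideal m n"
  shows "f * g - g * f \<in> enveloping_ideal m n"
  using assms(2) unfolding free_algebra_eq_word_span
proof (induction f rule: word_span_induct)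
  case zero
  show ?case by (simp add: enveloping_ideal_zero)
next
  case (add f h)
  then show ?case using enveloping_ideal_add[OF add] by (simp add: algebra_simps)
next
  case (word c w)
  then have w: "set w \<subseteq> proper_symbols n \<times> proper_symbols n" by simp
  then have "monomial w * g - g * monomial w \<in> enveloping_ideal m n"
  proof (induction w)
    case Nil
    show ?case by (simp add: monomial_Nil enveloping_ideal_zero)
  next
    case (Cons z w)
    obtain i j where z: "z = (Proper i, Proper j)" and ij: "i \<in> {1..n}" "j \<in> {1..n}"
      using Cons.prems by (cases z) (auto simp: proper_symbols_def)
    have "monomial (z # w) * g - g * monomial (z # w)
        = gen (Proper i) (Proper j) * (monomial w * g - g * monomial w)
          + (gen (Proper i) (Proper j) * g - g * gen (Proper i) (Proper j)) * monomial w"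
      by (simp add: z monomial_Cons algebra_simps)
    also have "\<dots> \<in> enveloping_ideal m n"
      using Cons ij
      by (intro enveloping_ideal_add enveloping_ideal_left enveloping_ideal_right gens
          proper_algebra_subset gen_in_proper_algebra monomial_closed) (auto simp: proper_symbols_def)
    finally show ?case .
  qed
  then have "scal c * (monomial w * g - g * monomial w) \<in> enveloping_ideal m n"
    by (intro enveloping_ideal_left scal_closed)
  then show ?case by (simp add: algebra_simps scal_left_commute)
qed

text \<open>As \<open>e\<^sub>i\<^sub>j\<close> commutes with the product, its commutator with the proper component is, up to sign, the
  one with the component in \<open>Irr\<close>, which again lies in \<open>Irr\<close>. Being proper as well, it is \<open>0\<close>.\<close>

lemma devirt_central:
  assumes w: "set w \<subseteq> symbols m n \<times> symbols m n"
    and balanced: "\<And>g. Virtual g \<in> virtual_symbols m \<Longrightarrow> weight g w = 0"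
    and commutes: "\<And>i j. i \<in> {1..n} \<Longrightarrow> j \<in> {1..n} \<Longrightarrow>
      gen (Proper i) (Proper j) * monomial w - monomial w * gen (Proper i) (Proper j)
        \<in> enveloping_ideal m n"
  shows "devirt m n (U_prod m n w) \<in> center (U_gl m n)"
proof -
  interpret U: ring "U_super m n" by (rule ring_U_super)
  let ?x = "monomial w" and ?g = "devirt_rep (monomial w)"
  have x: "?x \<in> carrier (tensor_algebra m n)" using w by (rule monomial_closed)
  have g: "?g \<in> carrier (proper_algebra n)" using w balanced by (rule devirt_rep_balanced)
  have v: "?x - ?g \<in> Irr_rep m n" using w by (rule minus_devirt_rep)
  have "U_prod m n w = U_class m n (?g + (?x - ?g))" by (simp add: U_prod_eq w)
  also have "\<dots> = U_class m n ?g \<oplus>\<^bsub>U_super m n\<^esub> U_class m n (?x - ?g)"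
    using v by (intro U_class_add proper_algebra_subset[OF g]) (simp add: Irr_rep_def)
  finally have devirt: "devirt m n (U_prod m n w) = U_class m n ?g"
    using v g by (simp add: devirt_eq Irr_rep_def carrier_U_gl)
  have "gen (Proper i) (Proper j) * ?g - ?g * gen (Proper i) (Proper j) \<in> enveloping_ideal m n"
    if ij: "i \<in> {1..n}" "j \<in> {1..n}" for i j
  proof -
    let ?e = "gen (Proper i) (Proper j)"
    have P: "Proper i \<in> proper_symbols n" "Proper j \<in> proper_symbols n"
      using ij by (simp_all add: proper_symbols_def)
    then have e: "?e \<in> carrier (proper_algebra n)" by (rule gen_in_proper_algebra)
    then have e': "?e \<in> carrier (tensor_algebra m n)" by (rule proper_algebra_subset)
    have "(?x - ?g) * ?e \<in> Irr_rep m n"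
      using v Irr_right_proper[OF _ P] e' by (simp add: Irr_rep_def U_class_mult free_algebra_mult)
    then have "(?e * ?x - ?x * ?e) - ?e * (?x - ?g) + (?x - ?g) * ?e \<in> Irr_rep m n"
      using Irr_rep_enveloping_ideal[OF commutes[OF ij]] Irr_rep_left[OF e' v]
        Irr_rep_add[OF Irr_rep_diff] by blast
    moreover have "(?e * ?x - ?x * ?e) - ?e * (?x - ?g) + (?x - ?g) * ?e = ?e * ?g - ?g * ?e"
      by (simp add: algebra_simps)
    ultimately show ?thesis
      using e g by (intro Irr_proper_zero free_algebra_diff free_algebra_mult) (simp_all add: Irr_rep_def)
  qed
  then have comm: "f * ?g - ?g * f \<in> enveloping_ideal m n" if "f \<in> carrier (proper_algebra n)" for f
    using commutes_with_U_gl[OF proper_algebra_subset[OF g] that] by blast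
  have "U_class m n ?g \<otimes>\<^bsub>U_super m n\<^esub> U_class m n f = U_class m n f \<otimes>\<^bsub>U_super m n\<^esub> U_class m n ?g"
    if f: "f \<in> carrier (proper_algebra n)" for f
  proof -
    have "U_class m n (f * ?g) = U_class m n (?g * f)"
      using comm[OF f] f g by (subst U_class_eq_iff) (simp_all add: proper_algebra_subset free_algebra_mult)
    then show ?thesis using f g by (simp add: U_class_mult proper_algebra_subset)
  qed
  moreover have "monoid.mult (U_gl m n) = monoid.mult (U_super m n)" by (simp add: U_gl_def)
  ultimately show ?thesis
    using g by (auto simp: devirt center_def carrier_U_gl)
qed

lemma weight_append: "weight g (u @ v) = weight g u + weight g v"
  by (simp add: weight_def)

lemma weight_concat: "weight g (concat ws) = (\<Sum>w \<leftarrow> ws. weight g w)"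
  by (induction ws) (simp_all add: weight_append, simp add: weight_def)

lemma map2_replicate: "map2 f xs (replicate (length xs) y) = map (\<lambda>x. f x y) xs"
  by (induction xs) auto

lemma weight_rows:
  "weight g (map (\<lambda>s. (Proper s, \<alpha>)) ss) = - (of_bool (\<alpha> = Virtual g) * int (length ss))"
  "weight g (map (\<lambda>t. (\<alpha>, Proper t)) ss) = of_bool (\<alpha> = Virtual g) * int (length ss)"
  by (induction ss) (auto simp: weight_def)

theorem proposition4:
  fixes n p m :: nat and \<alpha>s :: "symbol list"
  assumes "n > 0" and "p > 0"
    and "length \<alpha>s = p" and "distinct \<alpha>s" and "set \<alpha>s \<subseteq> virtual_symbols m"
  shows "capelli_deruyts m n \<alpha>s p \<in> center (U_gl m n)"
proof -
  let ?S = "\<lambda>\<alpha>. map (\<lambda>s. (Proper s, \<alpha>)) (rev [1..<Suc n])"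
  let ?T = "\<lambda>\<alpha>. map (\<lambda>t. (\<alpha>, Proper t)) [1..<Suc n]"
  let ?u = "concat (map ?S \<alpha>s)" and ?v = "concat (map ?T \<alpha>s)"
  have u: "monomial ?u = prod_list (map (\<lambda>\<alpha>. monomial (?S \<alpha>)) \<alpha>s)"
    and v: "monomial ?v = prod_list (map (\<lambda>\<alpha>. monomial (?T \<alpha>)) \<alpha>s)"
    by (simp_all only: monomial_concat map_map o_def)
  have "capelli_deruyts m n \<alpha>s p = devirt m n (U_prod m n (?u @ ?v))"
    unfolding capelli_deruyts_def capelli_bitableau_def assms(3)[symmetric] map2_replicate ..
  also have "\<dots> \<in> center (U_gl m n)"
  \<comment> \<open>The rows of \<open>S\<close> contribute the eigenvalue \<open>p \<cdot> \<delta>\<^sub>i\<^sub>j\<close> and those of \<open>T\<close> its negative.\<close>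
  proof (rule devirt_central)
    show "set (?u @ ?v) \<subseteq> symbols m n \<times> symbols m n"
      using assms(5) by (auto simp: symbols_def proper_symbols_def)
    show "weight g (?u @ ?v) = 0" for g
      unfolding weight_append weight_concat by (simp add: o_def weight_rows del: upt_Suc flip: sum_list_addf)
    fix i j assume ij: "i \<in> {1..n}" "j \<in> {1..n}"
    let ?e = "gen (Proper i) (Proper j)" and ?c = "if j = i then 1 else 0 :: complex"
    have "ad_eigen m n ?e (of_nat p * ?c) (monomial ?u)"
      unfolding u assms(3)[symmetric] using assms(5) ij
      by (intro ad_eigen_prod_list ad_eigen_annihilating_row) auto
    moreover have "ad_eigen m n ?e (of_nat p * (if j = i then - 1 else 0)) (monomial ?v)"
      unfolding v assms(3)[symmetric] using assms(5) ij
      by (intro ad_eigen_prod_list ad_eigen_creating_row) auto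
    ultimately have "ad_eigen m n ?e (of_nat p * ?c + of_nat p * (if j = i then - 1 else 0))
        (monomial (?u @ ?v))"
      unfolding monomial_append by (rule ad_eigen_mult)
    moreover have "of_nat p * ?c + of_nat p * (if j = i then - 1 else 0) = 0" by simp
    ultimately show "?e * monomial (?u @ ?v) - monomial (?u @ ?v) * ?e \<in> enveloping_ideal m n"
      unfolding ad_eigen_def by simp
  qed
  finally show ?thesis .
qed

end
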